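(* There exist an absolute constant $C>0$ and a randomized algorithm (in the real RAM model described in the context) which, given integers $n\ge 2$ and $m$ with $n \le m \le n\log n$, outputs a random vector $(X_0, X_1, \ldots, X_{K_n})$ whose law is exactly the law of the vector of bin cardinalities of $m$ balls thrown independently and uniformly at random into $n$ bins, and whose running time $T_{n,m}$ satisfies \[ \mathbb{E}[T_{n,m}] \le C\cdot \frac{\log n}{\log\left(\frac{4n}{m}\log n\right)} \] and, for some function $\varepsilon(n)\to 0$ as $n\to\infty$ (not depending on $m$), \[ \Pr\left[T_{n,m} \le C\cdot \frac{\log n}{\log\left(\frac{4n}{m}\log n\right)}\right] \ge 1-\varepsilon(n). \]
   Context: Balls-into-bins: $m$ balls are thrown independently, each into a bin chosen uniformly at random among $n$ bins; $N_i$ denotes the number of balls in bin $i$ (equivalently $(N_1,\dots,N_n)$ is $\mathrm{Multinomial}(m;1/n,\ldots,1/n)$). The vector of bin cardinalities is $(X_0, X_1, \ldots)$ with $X_j = \sum_{i=1}^n \mathbf{1}_{\{N_i = j\}}$, and $K_n = \max_i N_i$ is the maximum occupancy; the algorithm outputs $(X_0,\dots,X_{K_n})$ (with $X_j=0$ understood for $j>K_n$). Computational model: idealized real RAM, in which real numbers are stored exactly and addition, multiplication, division, comparison, truncation, exponentiation, logarithms and trigonometric functions each take constant time, and an i.i.d. sequence of $\mathrm{Uniform}(0,1)$ random variables is available at unit cost per variable. Logarithms are natural. *)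

theory Defs
  imports "HOL-Probability.Probability"
begin

section \<open>An idealized real RAM\<close>

text \<open>
  A program works on registers that are indexed by natural numbers and hold real numbers exactly,
  with indirect addressing, and reads an infinite supply of random reals.  The only constants are
  integers: with arbitrary real constants, a single constant together with truncation could hide
  an infinite table of precomputed values.
\<close>

datatype unop = Floor | Exp | Ln | Sin | Cos | Tan

datatype binop = Add | Sub | Mul | Div | Pow

datatype expr =
    Const int
  | Load expr
  | Unary unop expr
  | Binary binop expr expr

datatype test =
    Less expr expr
  | Leq expr expr
  | Equal expr expr

text \<open>
  \<open>Store a e\<close> writes the value of \<open>e\<close> to the register with address \<open>a\<close>; \<open>Sample a\<close> writes the
  next random number there.
\<close>

datatype cmd =
    Skip
  | Store expr expr
  | Sample expr
  | Seq cmd cmd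
  | Cond test cmd cmd
  | While test cmd

type_synonym memory = "nat \<Rightarrow> real"

text \<open>
  Undefined operations take the values of the HOL functions: division by zero gives 0,
  \<open>ln 0 = 0\<close>, \<open>ln (- x) = ln x\<close>, \<open>0 powr y = 0\<close> and \<open>x powr y = exp (y * ln x)\<close> otherwise.
\<close>

fun unop_val :: "unop \<Rightarrow> real \<Rightarrow> real" where
  "unop_val Floor x = real_of_int \<lfloor>x\<rfloor>"
| "unop_val Exp x = exp x"
| "unop_val Ln x = ln x"
| "unop_val Sin x = sin x"
| "unop_val Cos x = cos x"
| "unop_val Tan x = tan x"

fun binop_val :: "binop \<Rightarrow> real \<Rightarrow> real \<Rightarrow> real" where
  "binop_val Add x y = x + y"
| "binop_val Sub x y = x - y"
| "binop_val Mul x y = x * y"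
| "binop_val Div x y = x / y"
| "binop_val Pow x y = x powr y"

definition address :: "real \<Rightarrow> nat" where
  "address x = nat \<lfloor>x\<rfloor>"

fun expr_val :: "expr \<Rightarrow> memory \<Rightarrow> real" where
  "expr_val (Const k) M = real_of_int k"
| "expr_val (Load a) M = M (address (expr_val a M))"
| "expr_val (Unary f a) M = unop_val f (expr_val a M)"
| "expr_val (Binary f a b) M = binop_val f (expr_val a M) (expr_val b M)"

fun test_val :: "test \<Rightarrow> memory \<Rightarrow> bool" where
  "test_val (Less a b) M \<longleftrightarrow> expr_val a M < expr_val b M"
| "test_val (Leq a b) M \<longleftrightarrow> expr_val a M \<le> expr_val b M"
| "test_val (Equal a b) M \<longleftrightarrow> expr_val a M = expr_val b M"

fun expr_cost :: "expr \<Rightarrow> nat" where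
  "expr_cost (Const k) = 1"
| "expr_cost (Load a) = 1 + expr_cost a"
| "expr_cost (Unary f a) = 1 + expr_cost a"
| "expr_cost (Binary f a b) = 1 + expr_cost a + expr_cost b"

fun test_cost :: "test \<Rightarrow> nat" where
  "test_cost (Less a b) = 1 + expr_cost a + expr_cost b"
| "test_cost (Leq a b) = 1 + expr_cost a + expr_cost b"
| "test_cost (Equal a b) = 1 + expr_cost a + expr_cost b"

text \<open>
  \<open>exec c s t s'\<close>: started in state \<open>s\<close>, the command \<open>c\<close> halts after exactly \<open>t\<close> unit-time
  operations in state \<open>s'\<close>.  A state consists of the memory and the random numbers not yet read.
\<close>

inductive exec :: "cmd \<Rightarrow> memory \<times> real stream \<Rightarrow> nat \<Rightarrow> memory \<times> real stream \<Rightarrow> bool" where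
  Skip: "exec Skip s 1 s"
| Store: "exec (Store a e) (M, \<omega>) (1 + expr_cost a + expr_cost e)
      (M(address (expr_val a M) := expr_val e M), \<omega>)"
| Sample: "exec (Sample a) (M, \<omega>) (1 + expr_cost a)
      (M(address (expr_val a M) := shd \<omega>), stl \<omega>)"
| Seq: "exec c1 s1 t1 s2 \<Longrightarrow> exec c2 s2 t2 s3 \<Longrightarrow> exec (Seq c1 c2) s1 (t1 + t2) s3"
| CondTrue: "test_val b (fst s) \<Longrightarrow> exec c1 s t s' \<Longrightarrow>
      exec (Cond b c1 c2) s (test_cost b + t) s'"
| CondFalse: "\<not> test_val b (fst s) \<Longrightarrow> exec c2 s t s' \<Longrightarrow>
      exec (Cond b c1 c2) s (test_cost b + t) s'"
| WhileFalse: "\<not> test_val b (fst s) \<Longrightarrow> exec (While b c) s (test_cost b) s"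
| WhileTrue: "test_val b (fst s1) \<Longrightarrow> exec c s1 t1 s2 \<Longrightarrow> exec (While b c) s2 t2 s3 \<Longrightarrow>
      exec (While b c) s1 (test_cost b + t1 + t2) s3"

inductive_cases SkipE: "exec Skip s t s'"
inductive_cases StoreE: "exec (Store a e) s t s'"
inductive_cases SampleE: "exec (Sample a) s t s'"
inductive_cases SeqE: "exec (Seq c1 c2) s t s'"
inductive_cases CondE: "exec (Cond b c1 c2) s t s'"
inductive_cases WhileE: "exec (While b c) s t s'"

lemma exec_deterministic:
  "exec c s t s' \<Longrightarrow> exec c s u s'' \<Longrightarrow> u = t \<and> s'' = s'"
proof (induction arbitrary: u s'' rule: exec.induct)
  case (Skip s)
  then show ?case by (auto elim: SkipE)
next
  case (Store a e M \<omega>)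
  then show ?case by (auto elim: StoreE)
next
  case (Sample a M \<omega>)
  then show ?case by (auto elim: SampleE)
next
  case (Seq c1 s1 t1 s2 c2 t2 s3)
  from Seq.prems show ?case by (rule SeqE) (use Seq.IH in blast)
next
  case (CondTrue b s c1 t s' c2)
  from CondTrue.prems show ?case by (rule CondE) (use CondTrue.IH CondTrue.hyps in blast)+
next
  case (CondFalse b s c2 t s' c1)
  from CondFalse.prems show ?case by (rule CondE) (use CondFalse.IH CondFalse.hyps in blast)+
next
  case (WhileFalse b s c)
  from WhileFalse.prems show ?case by (rule WhileE) (use WhileFalse.hyps in blast)+
next
  case (WhileTrue b s1 c t1 s2 t2 s3)
  from WhileTrue.prems show ?case by (rule WhileE) (use WhileTrue.IH WhileTrue.hyps in blast)+
qed

text \<open>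
  The inputs \<open>n\<close> and \<open>m\<close> are in registers 0 and 1.  On halting, register 0 contains the length
  of the output vector and the registers from 1 on contain its entries.
\<close>

definition initial_memory :: "nat \<Rightarrow> nat \<Rightarrow> memory" where
  "initial_memory n m = (\<lambda>_. 0)(0 := real n, 1 := real m)"

definition outputs :: "cmd \<Rightarrow> nat \<Rightarrow> nat \<Rightarrow> real stream \<Rightarrow> real list \<Rightarrow> bool" where
  "outputs p n m \<omega> xs \<longleftrightarrow>
     (\<exists>t M \<omega>'. exec p (initial_memory n m, \<omega>) t (M, \<omega>') \<and>
        M 0 = real (length xs) \<and> (\<forall>i < length xs. M (Suc i) = xs ! i))"

text \<open>By determinism the set below has at most one element; if it is empty (the program does not
  halt), the running time is \<open>\<infinity>\<close>.\<close>

definition running_time :: "cmd \<Rightarrow> nat \<Rightarrow> nat \<Rightarrow> real stream \<Rightarrow> ennreal" where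
  "running_time p n m \<omega> = (INF t \<in> {t. \<exists>s'. exec p (initial_memory n m, \<omega>) t s'}. of_nat t)"

lemma running_time_eq:
  assumes "exec p (initial_memory n m, \<omega>) t s'"
  shows "running_time p n m \<omega> = of_nat t"
proof -
  have "{t. \<exists>s'. exec p (initial_memory n m, \<omega>) t s'} = {t}"
    using assms exec_deterministic by blast
  then show ?thesis
    by (simp add: running_time_def)
qed

lemma outputs_unique:
  assumes "outputs p n m \<omega> xs" "outputs p n m \<omega> ys"
  shows "xs = ys"
proof -
  obtain t M \<omega>' where 1: "exec p (initial_memory n m, \<omega>) t (M, \<omega>')"
      "M 0 = real (length xs)" "\<forall>i < length xs. M (Suc i) = xs ! i"
    using assms(1) unfolding outputs_def by blast
  obtain u M' \<omega>'' where 2: "exec p (initial_memory n m, \<omega>) u (M', \<omega>'')"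
      "M' 0 = real (length ys)" "\<forall>i < length ys. M' (Suc i) = ys ! i"
    using assms(2) unfolding outputs_def by blast
  have "M' = M"
    using exec_deterministic[OF 1(1) 2(1)] by simp
  with 1 2 show ?thesis
    by (intro nth_equalityI) auto
qed

definition random_source :: "real stream measure" where
  "random_source = stream_space (uniform_measure lborel {0<..<1})"


section \<open>Bin cardinalities\<close>

text \<open>An allocation \<open>f\<close> maps each ball \<open>b < m\<close> to its bin \<open>f b < n\<close>.\<close>

definition allocation_pmf :: "nat \<Rightarrow> nat \<Rightarrow> (nat \<Rightarrow> nat) pmf" where
  "allocation_pmf n m = Pi_pmf {..<m} 0 (\<lambda>_. pmf_of_set {..<n})"

definition occupancy :: "nat \<Rightarrow> (nat \<Rightarrow> nat) \<Rightarrow> nat \<Rightarrow> nat" where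
  "occupancy m f i = card {b. b < m \<and> f b = i}"

definition max_occupancy :: "nat \<Rightarrow> nat \<Rightarrow> (nat \<Rightarrow> nat) \<Rightarrow> nat" where
  "max_occupancy n m f = Max (occupancy m f ` {..<n})"

definition bin_cardinality :: "nat \<Rightarrow> nat \<Rightarrow> (nat \<Rightarrow> nat) \<Rightarrow> nat \<Rightarrow> nat" where
  "bin_cardinality n m f j = card {i. i < n \<and> occupancy m f i = j}"

definition bin_cardinalities :: "nat \<Rightarrow> nat \<Rightarrow> (nat \<Rightarrow> nat) \<Rightarrow> nat list" where
  "bin_cardinalities n m f = map (bin_cardinality n m f) [0..<Suc (max_occupancy n m f)]"

definition bin_cardinalities_pmf :: "nat \<Rightarrow> nat \<Rightarrow> nat list pmf" where
  "bin_cardinalities_pmf n m = map_pmf (bin_cardinalities n m) (allocation_pmf n m)"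

end

theory Submission
  imports Defs
begin

text \<open>
  On the real RAM, exponentiation and truncation let a bounded number of operations read off any
  coefficient of a power series from its exact value at a sufficiently small point.  This gives
  binomial coefficients, factorials, the power of 2 in a number and, through the powers of
  \<open>\<beta> z\<^sup>j / j! + (\<Sum>i>j. z\<^sup>i / i!)\<close>, the exact conditional law of \<open>X\<^sub>j\<close> given \<open>X\<^sub>0, \<dots>, X\<^bsub>j-1\<^esub>\<close>,
  encoded as the digits of one integer.  Inversion of this law amounts to counting the digits of an
  integer that exceed a threshold, which by Kummer's theorem is the power of 2 in a binomial
  coefficient.  Hence a single uniform random number and a constant number of operations for each
  \<open>j \<le> K\<^sub>n\<close> suffice, and the running time is an affine function of \<open>K\<^sub>n\<close>.  With
  \<open>D = 4 n log n / m\<close>, Markov's inequality for the moment generating function of \<open>N\<^sub>i\<close> at \<open>log D / 2\<close>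
  and a union bound show that \<open>K\<^sub>n\<close> exceeds \<open>12 log n / log D\<close> with probability at most \<open>n\<^bsup>-3\<^esup>\<close>.
\<close>

section \<open>Reading coefficients off real numbers\<close>

text \<open>The obstacle is that a level may cost only a bounded number of operations, while the
  conditional law of \<open>X_j\<close> may have up to n + 1 atoms, each of them a coefficient of a
  power of a truncated exponential series. Neither the atoms nor their partial sums can be visited
  one by one; they are packed as blocks of digits into a single real number, and every operation
  acts on all blocks at once. The model does not charge for the size of numbers, so evaluation
  points and bases may be crude: a bound only has to be computable from n and m by finitely many
  operations with integer constants. This is why factorials and binomial coefficients are themselves
  read off rather than supplied. Truncation recovers integers exactly, and one common factor
  \<open>fact m\<close> makes the weights of every level integral. The factor 4 in D gives D \<ge> 4
  because m \<le> n log n, so log D stays away from 0; from n \<le> m also log D \<le> D \<le> 4 log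
  n, hence log n / log D \<ge> 1/4, which absorbs additive costs.\<close>

definition rmod :: "real \<Rightarrow> real \<Rightarrow> real" where
  "rmod p q = p - q * of_int \<lfloor>p / q\<rfloor>"

lemma rmod_of_nat: "rmod (real p) (real q) = real (p mod q)"
proof -
  have "real p = real (p div q) * real q + real (p mod q)"
    by (metis div_mult_mod_eq of_nat_add of_nat_mult)
  then show ?thesis
    unfolding rmod_def floor_divide_of_nat_eq by (simp add: mult.commute del: div_mult_mod_eq)
qed

definition series_digit :: "real \<Rightarrow> real \<Rightarrow> real \<Rightarrow> real" where
  "series_digit F q k = rmod (of_int \<lfloor>F * q powr k\<rfloor>) q"

text \<open>Multiplying by \<open>q ^ k\<close> turns the terms below k into a multiple of q, leaves
  \<open>g k\<close> in the units place and pushes the tail to at most \<open>s / q < 1\<close>. The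
  value \<open>s\<close> at the point 1 thus controls both the tail and the size of the coefficient
  itself. Integrality is required only up to index k; later coefficients may be arbitrary
  nonnegative reals.\<close>

lemma series_digit:
  fixes c :: "nat \<Rightarrow> real" and g :: "nat \<Rightarrow> nat" and q k :: nat
  assumes F: "(\<lambda>i. c i * (1 / real q) ^ i) sums F" and s: "c sums s" and sq: "s < real q"
    and nonneg: "\<And>i. 0 \<le> c i" and g: "\<And>i. i \<le> k \<Longrightarrow> c i = real (g i)"
  shows "series_digit F (real q) (real k) = real (g k)"
proof -
  let ?z = "1 / real q"
  have s0: "0 \<le> s" using sums_le[OF _ sums_zero s] nonneg by simp
  then have q: "0 < q" using sq by simp
  have z1: "0 \<le> ?z" "?z \<le> 1" using q by auto
  define T where "T = (\<Sum>n. c (n + Suc k) * ?z ^ (n + Suc k))"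
  define J where "J = (\<Sum>i<k. g i * q ^ (k - Suc i))"
  have sumF: "summable (\<lambda>i. c i * ?z ^ i)" and Fe: "F = (\<Sum>i. c i * ?z ^ i)"
    using F by (auto simp: sums_iff)
  have sumc: "summable c" and se: "s = suminf c" using s by (auto simp: sums_iff)
  have Fsplit: "F = T + (\<Sum>i<Suc k. c i * ?z ^ i)"
    unfolding Fe T_def by (rule suminf_split_initial_segment[OF sumF])
  have sumT: "summable (\<lambda>n. c (n + Suc k) * ?z ^ (n + Suc k))"
    using summable_iff_shift[of "\<lambda>i. c i * ?z ^ i" "Suc k"] sumF by blast
  have sumc': "summable (\<lambda>n. c (n + Suc k))" using sumc by (simp only: summable_iff_shift)
  have T0: "0 \<le> T" unfolding T_def
    by (rule suminf_nonneg[OF sumT]) (use nonneg z1 in auto)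
  have "T \<le> (\<Sum>n. ?z ^ Suc k * c (n + Suc k))" unfolding T_def
  proof (rule suminf_le[OF _ sumT summable_mult[OF sumc']])
    fix n
    have "?z ^ (n + Suc k) \<le> ?z ^ Suc k" using z1 by (intro power_decreasing) auto
    then show "c (n + Suc k) * ?z ^ (n + Suc k) \<le> ?z ^ Suc k * c (n + Suc k)"
      using nonneg[of "n + Suc k"] by (simp only: mult.commute[of "c _"] mult_right_mono)
  qed
  also have "\<dots> = ?z ^ Suc k * (\<Sum>n. c (n + Suc k))" by (rule suminf_mult[OF sumc'])
  also have "\<dots> \<le> ?z ^ Suc k * s"
  proof (rule mult_left_mono)
    have "s = (\<Sum>n. c (n + Suc k)) + (\<Sum>i<Suc k. c i)"
      unfolding se by (rule suminf_split_initial_segment[OF sumc])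
    moreover have "0 \<le> (\<Sum>i<Suc k. c i)" by (rule sum_nonneg) (rule nonneg)
    ultimately show "(\<Sum>n. c (n + Suc k)) \<le> s" by linarith
  qed (use z1 in simp)
  finally have Tle: "T \<le> ?z ^ Suc k * s" .
  have "T * q ^ k \<le> ?z ^ Suc k * s * q ^ k" using Tle by (rule mult_right_mono) simp
  also have "\<dots> = s / q" using q by (simp add: field_simps)
  also have "\<dots> < 1" using sq q by simp
  finally have T1: "T * q ^ k < 1" .
  have "(\<Sum>i<k. c i * ?z ^ i) * q ^ k = real q * real J"
    unfolding J_def of_nat_sum sum_distrib_left sum_distrib_right
  proof (rule sum.cong[OF refl])
    fix i assume "i \<in> {..<k}"
    then have i: "i < k" by simp
    then have "real q ^ k = real q ^ i * (real q * real q ^ (k - Suc i))"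
      by (metis Suc_diff_Suc le_add_diff_inverse less_imp_le power_Suc power_add)
    then show "c i * ?z ^ i * q ^ k = real q * real (g i * q ^ (k - Suc i))"
      using q g[of i] i by (simp add: field_simps power_one_over)
  qed
  then have "F * q ^ k = real (g k + q * J) + T * q ^ k"
    using Fsplit q g[of k] by (simp add: field_simps power_one_over)
  then have "\<lfloor>F * real q powr real k\<rfloor> = int (g k + q * J)"
    using T0 T1 q by (intro floor_unique) (auto simp: powr_realpow)
  then have eq: "series_digit F (real q) (real k) = real ((g k + q * J) mod q)"
    unfolding series_digit_def by (simp only: of_int_of_nat_eq rmod_of_nat)
  have "(\<Sum>i\<in>{k}. c i) \<le> s" unfolding se
    by (rule sum_le_suminf[OF sumc]) (use nonneg in auto)
  then have "g k < q" using sq g[of k] by simp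
  then show ?thesis using eq by simp
qed

text \<open>The generating function \<open>(1 + z) ^ N\<close> at z = 1/q. Its value at 1 is
  \<open>2 ^ N\<close>, which is why q is one more than that.\<close>

definition rbinomial :: "real \<Rightarrow> real \<Rightarrow> real" where
  "rbinomial N k = series_digit ((1 + 1 / (2 powr N + 1)) powr N) (2 powr N + 1) k"

lemma rbinomial_of_nat: "rbinomial (real N) (real k) = real (N choose k)"
proof -
  define q :: nat where "q = 2 ^ N + 1"
  have q: "2 powr real N + 1 = real q" by (simp add: q_def powr_realpow)
  have fin: "(\<lambda>i. if i \<in> {..N} then f i else 0) sums (\<Sum>i\<le>N. f i)" for f :: "nat \<Rightarrow> real"
    by (rule sums_If_finite_set) simp
  have ext: "(\<lambda>i. if i \<in> {..N} then real (N choose i) * w ^ i else 0) = (\<lambda>i. real (N choose i) * w ^ i)"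
    for w :: real by (auto simp: fun_eq_iff binomial_eq_0)
  have bin: "(\<lambda>i. real (N choose i) * w ^ i) sums (1 + w) ^ N" for w :: real
    using fin[of "\<lambda>i. real (N choose i) * w ^ i"]
    unfolding ext using binomial_ring[of w 1 N] by (simp add: add.commute)
  have "series_digit ((1 + 1 / real q) ^ N) (real q) (real k) = real (N choose k)"
  proof (rule series_digit)
    show "(\<lambda>i. real (N choose i) * (1 / real q) ^ i) sums (1 + 1 / real q) ^ N" by (rule bin)
    show "(\<lambda>i. real (N choose i)) sums 2 ^ N" using bin[of 1] by simp
  qed (auto simp: q_def)
  moreover have "(1 + 1 / real q) powr real N = (1 + 1 / real q) ^ N"
    by (rule powr_realpow) (simp add: q_def add_pos_nonneg)
  ultimately show ?thesis by (simp add: rbinomial_def q)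
qed

text \<open>\<open>R ^ m / (R choose m)\<close> decreases to \<open>fact m\<close> as \<open>R\<close> grows.\<close>

definition rfact :: "real \<Rightarrow> real" where
  "rfact m = (let R = 2 * m * m * (m powr m + 1) in of_int \<lfloor>R powr m / rbinomial R m\<rfloor>)"

text \<open>The quotient equals \<open>fact m / \<delta>\<close> with \<delta> the product of the
  factors 1 - i/R. Bernoulli's inequality gives \<delta> \<ge> 1 - m * m / R, and the choice of R
  together with \<open>fact m \<le> m ^ m\<close> makes the defect at most 1 / (2 * (fact m + 1)),
  so that the quotient stays below \<open>fact m + 1\<close>.\<close>

lemma rfact_of_nat:
  fixes m :: nat
  assumes "1 \<le> m"
  shows "rfact (real m) = fact m"
proof -
  define R :: nat where "R = 2 * m * m * (m ^ m + 1)"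
  have R: "2 * real m * real m * (real m powr real m + 1) = real R"
    using assms by (simp add: R_def powr_realpow algebra_simps)
  have "m * 1 \<le> m * (2 * m * (m ^ m + 1))" using assms by (intro mult_le_mono2) simp
  then have mR: "m \<le> R" by (simp add: R_def mult_ac)
  have R0: "0 < R" using assms by (simp add: R_def)
  define \<delta> where "\<delta> = (\<Prod>i<m. (1 - real i / R))"
  have "(1 - real m / R) ^ m \<le> \<delta>"
  proof -
    have "(\<Prod>i<m. (1 - real m / R)) \<le> \<delta>" unfolding \<delta>_def
      using mR R0 by (intro prod_mono) (auto simp: divide_right_mono)
    then show ?thesis by simp
  qed
  moreover have "1 + real m * (- (real m / R)) \<le> (1 + (- (real m / R))) ^ m"
    using mR R0 by (intro Bernoulli_inequality) simp
  ultimately have \<delta>lo: "1 - real m * real m / R \<le> \<delta>" by simp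
  have "real R = real m * real m * (2 * (real (m ^ m) + 1))"
    by (simp add: R_def algebra_simps)
  then have "real m * real m / R = 1 / (2 * (real (m ^ m) + 1))"
    using assms by simp
  also have "\<dots> \<le> 1 / (2 * (fact m + 1))"
    using fact_le_power[of m, where 'a = real]
    by (intro divide_left_mono mult_pos_pos) (auto intro: add_nonneg_pos)
  finally have "real m * real m / R \<le> 1 / (2 * (fact m + 1))" .
  with \<delta>lo have \<delta>1: "1 - 1 / (2 * (fact m + 1)) \<le> \<delta>" by simp
  have \<delta>2: "\<delta> \<le> 1" unfolding \<delta>_def using mR R0
    by (intro prod_le_1) (auto simp: field_simps)
  have f1: "(1::real) \<le> fact m" by simp
  have \<delta>0: "0 < \<delta>"
    by (rule less_le_trans[OF _ \<delta>1]) (use f1 in \<open>simp add: field_simps del: fact_ge_1\<close>)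
  have "real (R choose m) = (\<Prod>i<m. real R - real i) / fact m"
    using mR by (simp add: binomial_gbinomial gbinomial_prod_rev atLeast0LessThan)
  also have "(\<Prod>i<m. real R - real i) = (\<Prod>i<m. R * (1 - real i / R))"
    using R0 by (intro prod.cong) (auto simp: field_simps)
  also have "\<dots> = real R ^ m * \<delta>" by (simp add: prod.distrib \<delta>_def)
  finally have b: "real (R choose m) = real R ^ m * \<delta> / fact m" .
  have quot: "real R powr real m / rbinomial (real R) (real m) = fact m / \<delta>"
    using R0 \<delta>0 by (simp add: rbinomial_of_nat b powr_realpow field_simps)
  have "\<lfloor>fact m / \<delta>\<rfloor> = int (fact m)"
  proof (rule floor_unique)
    show "real_of_int (int (fact m)) \<le> fact m / \<delta>"
      using \<delta>0 \<delta>2 by (simp add: field_simps)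
    have "fact m < (fact m + 1) * (1 - 1 / (2 * (fact m + 1 :: real)))"
      using f1 by (simp add: field_simps del: fact_ge_1)
    also have "\<dots> \<le> (fact m + 1) * \<delta>" using \<delta>1 by (rule mult_left_mono) simp
    finally show "fact m / \<delta> < real_of_int (int (fact m)) + 1"
      using \<delta>0 by (simp add: field_simps)
  qed
  then show ?thesis
    unfolding rfact_def Let_def R quot by simp
qed

text \<open>The product of the two geometric sums enumerates the points \<open>(x, y)\<close> of the box
  \<open>x \<le> 2 ^ N\<close>, \<open>y \<le> N\<close> by the value of \<open>N * x + 2 ^ N * y\<close>.  The value \<open>N * 2 ^ N\<close> is taken
  exactly \<open>gcd N (2 ^ N) + 1\<close> times, and this gcd is the power of 2 in \<open>N\<close>.\<close>

definition rtwoval :: "real \<Rightarrow> real" where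
  "rtwoval N = (let P = 2 powr N; q = (N + 1) * (P + 1) + 1;
      a = (1 / q) powr N; b = (1 / q) powr P
    in ln (series_digit ((1 - a powr (P + 1)) / (1 - a) * ((1 - b powr (N + 1)) / (1 - b))) q (N * P) - 1)
      / ln 2)"

text \<open>Write N = 2^v * u with u odd. After division by 2^v the equation forces 2^(N - v) to
  divide x, so the solutions are \<open>(2 ^ (N - v) * t, N - u * t)\<close>, and the box restricts
  t to 0, ..., 2^v.\<close>

lemma card_lattice_points:
  fixes N :: nat
  assumes "0 < N"
  shows "card {p \<in> {..2 ^ N} \<times> {..N}. N * fst p + 2 ^ N * snd p = N * 2 ^ N} = 2 ^ multiplicity 2 N + 1"
proof -
  define v where "v = multiplicity 2 N"
  obtain u where u: "N = 2 ^ v * u" "\<not> 2 dvd u"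
    unfolding v_def by (rule multiplicity_decompose'[of N 2]) (use assms in auto)
  have "2 ^ v * 1 \<le> N" using u assms by (intro order.trans[OF mult_le_mono2 eq_refl[OF u(1)[symmetric]]]) (cases u, auto)
  then have "v \<le> N" using less_exp[of v] by linarith
  then have P: "(2::nat) ^ N = 2 ^ v * 2 ^ (N - v)" by (simp flip: power_add)
  let ?f = "\<lambda>t. (2 ^ (N - v) * t, N - u * t)"
  have "{p \<in> {..2 ^ N} \<times> {..N}. N * fst p + 2 ^ N * snd p = N * 2 ^ N} = ?f ` {..2 ^ v}" (is "?A = _")
  proof (intro equalityI subsetI)
    fix p assume "p \<in> ?A"
    then obtain x y where p: "p = (x, y)" and x: "x \<le> 2 ^ N" and y: "y \<le> N"
      and e: "N * x + 2 ^ N * y = N * 2 ^ N" by (cases p) auto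
    have "2 ^ v * (u * x + 2 ^ (N - v) * y) = 2 ^ v * (2 ^ (N - v) * N)"
      using e u(1) P by (simp add: algebra_simps)
    then have e': "u * x + 2 ^ (N - v) * y = 2 ^ (N - v) * N" by simp
    then have "2 ^ (N - v) dvd u * x"
      by (metis dvd_triv_left dvd_add_left_iff)
    moreover have "coprime (2 ^ (N - v)) u" using u(2) by simp
    ultimately have "2 ^ (N - v) dvd x" by (simp add: coprime_dvd_mult_right_iff)
    then obtain t where t: "x = 2 ^ (N - v) * t" by (elim dvdE)
    have "2 ^ (N - v) * (u * t + y) = 2 ^ (N - v) * N" using e' t by (simp add: algebra_simps)
    then have "u * t + y = N" by simp
    moreover have "t \<le> 2 ^ v" using x unfolding t P by simp
    ultimately show "p \<in> ?f ` {..2 ^ v}" using p t by (intro image_eqI[of _ _ t]) auto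
  next
    fix p assume "p \<in> ?f ` {..2 ^ v}"
    then obtain t where t: "t \<le> 2 ^ v" and p: "p = ?f t" by auto
    have ut: "u * t \<le> N" using t u(1) by (simp add: mult.commute)
    have "N * (2 ^ (N - v) * t) = 2 ^ N * (u * t)" using u(1) P by (metis mult.assoc mult.left_commute)
    then have "N * (2 ^ (N - v) * t) + 2 ^ N * (N - u * t) = 2 ^ N * N"
      using ut by (simp only: distrib_left[symmetric] le_add_diff_inverse)
    then show "p \<in> ?A" using t p P by (simp add: mult.commute)
  qed
  moreover have "inj_on ?f {..2 ^ v}" by (auto simp: inj_on_def)
  ultimately show ?thesis by (simp add: card_image v_def)
qed

lemma rtwoval_of_nat:
  fixes N :: nat
  assumes "0 < N"
  shows "rtwoval (real N) = real (multiplicity 2 N)"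
proof -
  define P :: nat where "P = 2 ^ N"
  \<comment> \<open>The coefficients of the generating function add up to the number (N + 1) * (P +
    1) of box points, which q has to exceed.\<close>
  define q :: nat where "q = (N + 1) * (P + 1) + 1"
  define A where "A = {..P} \<times> {..N}"
  define h where "h = (\<lambda>p. N * fst p + P * snd p)"
  define c where "c = (\<lambda>k. \<Sum>p\<in>A. if h p = k then 1 else 0 :: real)"
  have Pr: "2 powr real N = real P" by (simp add: P_def powr_realpow)
  have qr: "(real N + 1) * (real P + 1) + 1 = real q" by (simp add: q_def algebra_simps)
  have P0: "0 < P" by (simp add: P_def)
  have q1: "1 < q" by (simp add: q_def)
  have finA: "finite A" by (simp add: A_def)
  have c_card: "c k = real (card {p \<in> A. h p = k})" for k
    by (simp add: c_def finA sum.If_cases Int_def)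
  have sums: "(\<lambda>k. c k * w ^ k) sums (\<Sum>p\<in>A. w ^ h p)" for w :: real
  proof -
    have "(\<lambda>k. \<Sum>p\<in>A. if k = h p then w ^ k else 0) sums (\<Sum>p\<in>A. w ^ h p)"
      by (rule sums_sum) (rule sums_single)
    moreover have "(\<Sum>p\<in>A. if k = h p then w ^ k else 0) = c k * w ^ k" for k
      by (auto simp: c_def sum_distrib_right intro!: sum.cong)
    ultimately show ?thesis by simp
  qed
  define a where "a = (1 / real q) ^ N"
  define b where "b = (1 / real q) ^ P"
  have a1: "a < 1" "0 < a" and b1: "b < 1" "0 < b"
    unfolding a_def b_def using q1 assms P0 by (auto simp: power_less_one_iff)
  have "(\<Sum>p\<in>A. (1 / real q) ^ h p) = (\<Sum>x\<le>P. \<Sum>y\<le>N. a ^ x * b ^ y)"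
    by (simp add: A_def sum.cartesian_product h_def a_def b_def power_add power_mult case_prod_unfold)
  also have "\<dots> = (1 - a ^ (P + 1)) / (1 - a) * ((1 - b ^ (N + 1)) / (1 - b))"
    using a1 b1 by (simp add: sum_product[symmetric] sum_gp0)
  finally have F: "(\<Sum>p\<in>A. (1 / real q) ^ h p) = \<dots>" .
  have "series_digit (\<Sum>p\<in>A. (1 / real q) ^ h p) (real q) (real (N * P))
      = real (card {p \<in> A. h p = N * P})"
  proof (rule series_digit)
    show "(\<lambda>i. c i * (1 / real q) ^ i) sums (\<Sum>p\<in>A. (1 / real q) ^ h p)" by (rule sums)
    show "c sums real (card A)" using sums[of 1] by simp
    show "real (card A) < real q" by (simp add: A_def q_def mult.commute)
  qed (simp_all add: c_card)
  also have "{p \<in> A. h p = N * P} = {p \<in> {..2 ^ N} \<times> {..N}. N * fst p + 2 ^ N * snd p = N * 2 ^ N}"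
    by (simp add: A_def h_def P_def)
  finally have *: "series_digit (\<Sum>p\<in>A. (1 / real q) ^ h p) (real q) (real N * real P) - 1 = 2 ^ multiplicity 2 N"
    by (simp add: card_lattice_points[OF assms])
  have powr: "(1 / real q) powr real N = a" "(1 / real q) powr real P = b"
      "a powr (real P + 1) = a ^ (P + 1)" "b powr (real N + 1) = b ^ (N + 1)"
    using q1 powr_realpow[of a "P + 1"] powr_realpow[of b "N + 1"] a1 b1
    by (simp_all add: a_def b_def powr_realpow add.commute)
  show ?thesis
    unfolding rtwoval_def Let_def Pr qr powr F[symmetric] * by (simp add: ln_realpow)
qed

section \<open>Binary digit sums and the theorems of Legendre and Kummer for the prime 2\<close>

fun bit_count :: "nat \<Rightarrow> nat" where
  "bit_count n = (if n = 0 then 0 else n mod 2 + bit_count (n div 2))"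

declare bit_count.simps [simp del]

lemma bit_count_0 [simp]: "bit_count 0 = 0" and bit_count_1 [simp]: "bit_count (Suc 0) = 1"
  by (simp_all add: bit_count.simps[of 0] bit_count.simps[of "Suc 0"])

lemma bit_count_double_add: "e < 2 \<Longrightarrow> bit_count (2 * n + e) = e + bit_count n"
  by (subst bit_count.simps) auto

lemma multiplicity_2_fact_double:
  "multiplicity 2 (fact (2 * n) :: nat) = n + multiplicity 2 (fact n :: nat)"
proof (induction n)
  case (Suc n)
  have "fact (2 * Suc n) = (2 * Suc n) * (Suc (2 * n) * (fact (2 * n) :: nat))"
    by (simp add: algebra_simps)
  moreover have "multiplicity 2 (Suc (2 * n)) = 0" by (intro not_dvd_imp_multiplicity_0) simp
  ultimately show ?case
    using Suc by (simp add: prime_elem_multiplicity_mult_distrib del: mult_Suc mult_Suc_right)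
qed simp

text \<open>Legendre's formula, stated additively to avoid natural subtraction. The induction halves
  n: passing from \<open>fact k\<close> to \<open>fact (2 * k)\<close> adds k factors of 2, and a
  further odd factor adds none.\<close>

lemma multiplicity_2_fact: "multiplicity 2 (fact n :: nat) + bit_count n = n"
proof (induction n rule: less_induct)
  case (less n)
  show ?case
  proof (cases "n = 0")
    case False
    define k where "k = n div 2"
    have IH: "multiplicity 2 (fact k :: nat) + bit_count k = k"
      using False by (intro less) (simp add: k_def)
    show ?thesis
    proof (cases "even n")
      case True
      then have "n = 2 * k" by (simp add: k_def)
      then show ?thesis
        using IH bit_count_double_add[of 0 k] by (simp add: multiplicity_2_fact_double)
    next
      case odd: False
      then have n: "n = Suc (2 * k)" by (simp add: k_def)
      have "multiplicity 2 (Suc (2 * k)) = 0" by (intro not_dvd_imp_multiplicity_0) simp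
      moreover have "fact n = Suc (2 * k) * (fact (2 * k) :: nat)" by (simp add: n)
      ultimately have "multiplicity 2 (fact n :: nat) = k + multiplicity 2 (fact k :: nat)"
        by (simp add: prime_elem_multiplicity_mult_distrib multiplicity_2_fact_double del: mult_Suc)
      then show ?thesis
        using IH bit_count_double_add[of 1 k] n by simp
    qed
  qed simp
qed

text \<open>Kummer's theorem: the drop in digit sum from x and y to x + y is the number of carries.
  It follows from Legendre's formula for the three factorials.\<close>

lemma multiplicity_2_binomial:
  "multiplicity 2 ((x + y) choose y) + bit_count (x + y) = bit_count x + bit_count y"
proof -
  have "fact y * fact x * ((x + y) choose y) = (fact (x + y) :: nat)"
    using binomial_fact_lemma[of y "x + y"] by simp
  then have "multiplicity 2 (fact (x + y) :: nat) =
      multiplicity 2 (fact y :: nat) + multiplicity 2 (fact x :: nat) + multiplicity 2 ((x + y) choose y)"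
    by (metis (no_types, lifting) prime_elem_multiplicity_mult_distrib binomial_eq_0_iff fact_nonzero
        le_add2 linorder_not_le mult_eq_0_iff two_is_prime_nat prime_imp_prime_elem)
  then show ?thesis
    using multiplicity_2_fact[of x] multiplicity_2_fact[of y] multiplicity_2_fact[of "x + y"] by linarith
qed

lemma bit_count_add: "f < 2 ^ L \<Longrightarrow> bit_count (f + 2 ^ L * g) = bit_count f + bit_count g"
proof (induction L arbitrary: f)
  case (Suc L)
  have f: "f = 2 * (f div 2) + f mod 2" by simp
  have "f + 2 ^ Suc L * g = 2 * (f div 2 + 2 ^ L * g) + f mod 2" by (subst f) simp
  then have "bit_count (f + 2 ^ Suc L * g) = f mod 2 + bit_count (f div 2 + 2 ^ L * g)"
    by (simp only: bit_count_double_add[of "f mod 2"] mod_less_divisor pos2)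
  also have "\<dots> = f mod 2 + bit_count (f div 2) + bit_count g"
    using Suc.prems by (subst Suc.IH) auto
  also have "f mod 2 + bit_count (f div 2) = bit_count f"
    by (metis f bit_count_double_add mod_less_divisor pos2)
  finally show ?case .
qed simp

lemma bit_count_digit_sum:
  "(\<And>y. f y < 2 ^ L) \<Longrightarrow> bit_count (\<Sum>y\<le>a. f y * (2 ^ L) ^ y) = (\<Sum>y\<le>a. bit_count (f y))"
proof (induction a arbitrary: f)
  case (Suc a)
  have "(\<Sum>y\<le>Suc a. f y * (2 ^ L) ^ y) = f 0 + 2 ^ L * (\<Sum>y\<le>a. f (Suc y) * (2 ^ L) ^ y)"
    by (simp add: sum.atMost_Suc_shift sum_distrib_left mult_ac del: sum.atMost_Suc)
  then show ?case
    using Suc.IH[of "\<lambda>y. f (Suc y)"] Suc.prems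
    by (simp add: bit_count_add sum.atMost_Suc_shift del: sum.atMost_Suc)
qed simp

text \<open>Adding \<open>2 ^ k\<close> to every digit produces, in base 2, exactly one carry for each digit in which
  bit \<open>k\<close> is set; the two leading zero bits of each digit stop the propagation.\<close>

lemma multiplicity_2_binomial_digits:
  fixes f :: "nat \<Rightarrow> nat"
  assumes f: "\<And>y. f y < 2 ^ Suc k"
  defines "B \<equiv> 2 ^ (k + 2)"
  shows "multiplicity 2 (((\<Sum>y\<le>a. f y * B ^ y) + (\<Sum>y\<le>a. 2 ^ k * B ^ y)) choose (\<Sum>y\<le>a. 2 ^ k * B ^ y))
    = card {y. y \<le> a \<and> 2 ^ k \<le> f y}"
proof -
  have bc2: "bit_count 2 = 1" using bit_count_double_add[of 0 1] by simp
  have fB: "f y + 2 ^ k < 2 ^ (k + 2)" "f y < 2 ^ (k + 2)" for y using f[of y] by simp_all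
  have "(\<Sum>y\<le>a. f y * B ^ y) + (\<Sum>y\<le>a. 2 ^ k * B ^ y) = (\<Sum>y\<le>a. (f y + 2 ^ k) * B ^ y)"
    by (simp add: sum.distrib algebra_simps)
  then have "bit_count ((\<Sum>y\<le>a. f y * B ^ y) + (\<Sum>y\<le>a. 2 ^ k * B ^ y)) = (\<Sum>y\<le>a. bit_count (f y + 2 ^ k))"
    unfolding B_def using fB(1) by (simp only: bit_count_digit_sum)
  moreover have "bit_count (\<Sum>y\<le>a. f y * B ^ y) = (\<Sum>y\<le>a. bit_count (f y))"
    unfolding B_def using fB(2) by (simp only: bit_count_digit_sum)
  moreover have "bit_count (\<Sum>y\<le>a. 2 ^ k * B ^ y) = (\<Sum>y\<le>a. bit_count (2 ^ k))"
    unfolding B_def by (rule bit_count_digit_sum) simp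
  moreover have "bit_count (f y) + bit_count (2 ^ k) =
      bit_count (f y + 2 ^ k) + (if 2 ^ k \<le> f y then 1 else 0)" for y
  proof -
    have one: "bit_count (2 ^ k) = 1" using bit_count_add[of 0 k 1] by simp
    show ?thesis
    proof (cases "2 ^ k \<le> f y")
      case True
      define g where "g = f y - 2 ^ k"
      have g: "f y = g + 2 ^ k * 1" "g < 2 ^ k" using True f[of y] by (auto simp: g_def)
      \<comment> \<open>The set bit k moves to place k + 1. Two set bits have merged into one, which
        is the single carry of this digit.\<close>
      have *: "f y + 2 ^ k = g + 2 ^ k * 2" using g by simp
      show ?thesis
        unfolding * using True one g bit_count_add[of g k 2] bit_count_add[of g k 1] bc2 by simp
    next
      case False
      then show ?thesis using bit_count_add[of "f y" k 1] one by simp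
    qed
  qed
  then have "(\<Sum>y\<le>a. bit_count (f y)) + (\<Sum>y\<le>a. bit_count (2 ^ k)) =
      (\<Sum>y\<le>a. bit_count (f y + 2 ^ k)) + (\<Sum>y\<le>a. if 2 ^ k \<le> f y then 1 else 0)"
    by (simp only: sum.distrib[symmetric])
  moreover have "(\<Sum>y\<le>a. if 2 ^ k \<le> f y then 1 else 0) = card {y. y \<le> a \<and> 2 ^ k \<le> f y}"
    by (simp add: sum.If_cases Int_def)
  ultimately show ?thesis
    using multiplicity_2_binomial[of "\<Sum>y\<le>a. f y * B ^ y" "\<Sum>y\<le>a. 2 ^ k * B ^ y"] by linarith
qed

section \<open>Occupancy generating functions\<close>

text \<open>Exponential generating function of one bin holding at least j balls; the a-th power
  belongs to a such bins with labelled balls.\<close>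

definition tail_fps :: "nat \<Rightarrow> real fps" where
  "tail_fps j = Abs_fps (\<lambda>i. if j \<le> i then 1 / fact i else 0)"

text \<open>Here a bin with exactly j balls carries the weight \<beta>, so in the a-th power the
  exponent of \<beta> records the number of such bins.\<close>

definition marked_fps :: "real \<Rightarrow> nat \<Rightarrow> real fps" where
  "marked_fps \<beta> j = fps_const (\<beta> / fact j) * fps_X ^ j + tail_fps (Suc j)"

lemma tail_fps_nth: "fps_nth (tail_fps j) i = (if j \<le> i then 1 / fact i else 0)"
  by (simp add: tail_fps_def)

lemma monomial_nth: "fps_nth (fps_const c * fps_X ^ j :: real fps) i = (if i = j then c else 0)"
  by (simp add: fps_X_power_nth)

lemma tail_fps_0: "tail_fps 0 = fps_exp 1"
  by (simp add: tail_fps_def fps_eq_iff)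

lemma marked_fps_1: "marked_fps 1 j = tail_fps j"
  by (auto simp: marked_fps_def fps_eq_iff tail_fps_nth fps_X_power_nth not_le less_Suc_eq)

lemma tail_fps_Suc: "tail_fps (Suc j) = tail_fps j - fps_const (1 / fact j) * fps_X ^ j"
  using marked_fps_1[of j] by (simp add: marked_fps_def algebra_simps)

lemma conv_radius_monomial [simp]: "fps_conv_radius (fps_const c * fps_X ^ j :: real fps) = \<infinity>"
  using fps_conv_radius_mult[of "fps_const c" "fps_X ^ j :: real fps"] by simp

lemma conv_radius_tail [simp]: "fps_conv_radius (tail_fps j) = \<infinity>"
proof (induction j)
  case (Suc j)
  show ?case
    using fps_conv_radius_diff[of "tail_fps j" "fps_const (1 / fact j) * fps_X ^ j"] Suc
    by (simp add: tail_fps_Suc)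
qed (simp add: tail_fps_0)

lemma conv_radius_marked [simp]: "fps_conv_radius (marked_fps \<beta> j) = \<infinity>"
  using fps_conv_radius_add[of "fps_const (\<beta> / fact j) * fps_X ^ j" "tail_fps (Suc j)"]
  by (simp add: marked_fps_def)

lemma eval_monomial: "eval_fps (fps_const c * fps_X ^ j :: real fps) z = c * z ^ j"
  by (simp add: eval_fps_mult)

lemma eval_tail_0: "eval_fps (tail_fps 0) z = exp z"
  by (simp add: tail_fps_0)

lemma eval_tail_Suc: "eval_fps (tail_fps (Suc j)) z = eval_fps (tail_fps j) z - z ^ j / fact j"
  by (simp add: tail_fps_Suc eval_fps_diff eval_monomial)

lemma eval_marked: "eval_fps (marked_fps \<beta> j) z = \<beta> * (z ^ j / fact j) + eval_fps (tail_fps (Suc j)) z"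
  by (simp add: marked_fps_def eval_fps_add eval_monomial)

lemma sums_eval_power:
  fixes f :: "real fps"
  assumes "fps_conv_radius f = \<infinity>"
  shows "(\<lambda>i. fps_nth (f ^ a) i * z ^ i) sums eval_fps f z ^ a"
proof -
  have "fps_conv_radius (f ^ a) = \<infinity>" using fps_conv_radius_power[of f a] assms by simp
  then have "(\<lambda>i. fps_nth (f ^ a) i * z ^ i) sums eval_fps (f ^ a) z"
    by (intro sums_eval_fps) simp
  then show ?thesis using assms by (simp add: eval_fps_power)
qed

lemma eval_tail_nonneg: "0 \<le> z \<Longrightarrow> 0 \<le> eval_fps (tail_fps j) z"
  using sums_le[OF _ sums_zero sums_eval_power[of "tail_fps j" 1 z]] by (simp add: tail_fps_nth)

lemma eval_tail_pos:
  assumes "0 < z" shows "0 < eval_fps (tail_fps j) z"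
  using eval_tail_Suc[of j z] eval_tail_nonneg[of z "Suc j"] assms by (smt (verit) fact_gt_zero zero_less_divide_iff zero_less_power)

lemma eval_tail_le: "eval_fps (tail_fps j) 1 \<le> 3"
proof -
  have "eval_fps (tail_fps j) 1 \<le> exp 1"
    by (induction j) (auto simp: eval_tail_Suc eval_tail_0 intro: order.trans[rotated])
  then show ?thesis using exp_le by linarith
qed

lemma eval_marked_le:
  assumes "1 \<le> \<beta>" shows "eval_fps (marked_fps \<beta> j) 1 \<le> 3 * \<beta>"
proof -
  have "eval_fps (marked_fps \<beta> j) 1 \<le> \<beta> * (1 / fact j) + \<beta> * eval_fps (tail_fps (Suc j)) 1"
    using mult_right_mono[OF assms eval_tail_nonneg[of 1 "Suc j"]] by (simp add: eval_marked)
  also have "\<dots> = \<beta> * eval_fps (tail_fps j) 1" by (simp add: eval_tail_Suc algebra_simps)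
  also have "\<dots> \<le> \<beta> * 3" using assms by (intro mult_left_mono eval_tail_le) simp
  finally show ?thesis by simp
qed

text \<open>\<open>fact b * configurations j a b\<close> counts the ways to put \<open>b\<close> balls into \<open>a\<close> bins with at least
  \<open>j\<close> balls in each; \<open>fact b * level_weight j a b y\<close> counts those with exactly \<open>y\<close> bins
  containing \<open>j\<close> balls.\<close>

definition configurations :: "nat \<Rightarrow> nat \<Rightarrow> nat \<Rightarrow> real" where
  "configurations j a b = fps_nth (tail_fps j ^ a) b"

definition level_weight :: "nat \<Rightarrow> nat \<Rightarrow> nat \<Rightarrow> nat \<Rightarrow> real" where
  "level_weight j a b y = (if y \<le> a \<and> j * y \<le> b
     then real (a choose y) / fact j ^ y * configurations (Suc j) (a - y) (b - j * y) else 0)"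

lemma monomial_power_mult_nth:
  "fps_nth ((fps_const c * fps_X ^ j) ^ y * f) b = (if j * y \<le> b then c ^ y * fps_nth f (b - j * y) else 0)"
  for f :: "real fps"
proof -
  have "(fps_const c * fps_X ^ j) ^ y * f = fps_const (c ^ y) * (fps_X ^ (j * y) * f)"
    by (simp only: power_mult_distrib fps_const_power power_mult mult.assoc)
  then show ?thesis by (simp only: fps_mult_left_const_nth fps_X_power_mult_nth) simp
qed

text \<open>This polynomial in \<beta> is the source of the packing. At \<beta> = 1 it gives the
  total weight, and at an integer \<beta> = B exceeding the integral multiples of the weights it is
  the number that has them as digits to base B.\<close>

lemma marked_power_nth:
  "fps_nth (marked_fps \<beta> j ^ a) b = (\<Sum>y\<le>a. level_weight j a b y * \<beta> ^ y)"
proof -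
  have "marked_fps \<beta> j ^ a = (\<Sum>y\<le>a. of_nat (a choose y) * (fps_const (\<beta> / fact j) * fps_X ^ j) ^ y * tail_fps (Suc j) ^ (a - y))"
    unfolding marked_fps_def by (rule binomial_ring)
  then have "fps_nth (marked_fps \<beta> j ^ a) b = (\<Sum>y\<le>a. real (a choose y) *
      fps_nth ((fps_const (\<beta> / fact j) * fps_X ^ j) ^ y * tail_fps (Suc j) ^ (a - y)) b)"
    by (simp add: fps_sum_nth mult.assoc flip: fps_of_nat)
  also have "\<dots> = (\<Sum>y\<le>a. level_weight j a b y * \<beta> ^ y)"
    unfolding monomial_power_mult_nth
    by (intro sum.cong) (auto simp: level_weight_def configurations_def power_divide)
  finally show ?thesis .
qed

lemma sum_level_weight: "(\<Sum>y\<le>a. level_weight j a b y) = configurations j a b"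
  using marked_power_nth[of 1 j a b] by (simp add: marked_fps_1 configurations_def)

lemma power_nth_nonneg:
  fixes f :: "real fps"
  assumes "\<And>i. 0 \<le> fps_nth f i" shows "0 \<le> fps_nth (f ^ a) b"
proof (induction a arbitrary: b)
  case (Suc a)
  then show ?case using assms by (auto simp: fps_mult_nth intro!: sum_nonneg)
qed (simp add: fps_one_nth)

lemma configurations_nonneg: "0 \<le> configurations j a b"
  unfolding configurations_def by (rule power_nth_nonneg) (simp add: tail_fps_nth)

lemma level_weight_nonneg: "0 \<le> level_weight j a b y"
  by (simp add: level_weight_def configurations_nonneg)

lemma configurations_0: "configurations j 0 b = (if b = 0 then 1 else 0)"
  by (simp add: configurations_def fps_one_nth)

lemma configurations_eq_0: "b < j * a \<Longrightarrow> configurations j a b = 0"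
proof (induction a arbitrary: b)
  case (Suc a)
  have "fps_nth (tail_fps j) i * fps_nth (tail_fps j ^ a) (b - i) = 0" if "i \<le> b" for i
    using Suc that by (auto simp: tail_fps_nth configurations_def not_le)
  then have "(\<Sum>i=0..b. fps_nth (tail_fps j) i * fps_nth (tail_fps j ^ a) (b - i)) = 0"
    by (intro sum.neutral) auto
  then show ?case by (simp add: configurations_def fps_mult_nth)
qed simp

lemma configurations_le_pos: "0 < configurations j a b \<Longrightarrow> j * a \<le> b"
  using configurations_eq_0 by (metis linorder_not_le less_irrefl)

lemma configurations_from_0: "configurations 0 n m = real n ^ m / fact m"
  by (simp add: configurations_def tail_fps_0 fps_exp_power_mult)

lemma sum_in_Nats: "(\<And>i. i \<in> A \<Longrightarrow> f i \<in> \<nat>) \<Longrightarrow> sum f A \<in> (\<nat> :: 'a :: semiring_1 set)"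
  by (induction A rule: infinite_finite_induct) auto

section \<open>Integrality of the scaled weights\<close>

definition egf_integral :: "real fps \<Rightarrow> bool" where
  "egf_integral f \<longleftrightarrow> (\<forall>i. fact i * fps_nth f i \<in> \<nat>)"

text \<open>The product of exponential generating functions is binomial convolution of the
  underlying sequences, which preserves natural numbers.\<close>

lemma egf_integral_mult:
  assumes "egf_integral f" "egf_integral g" shows "egf_integral (f * g)"
  unfolding egf_integral_def
proof
  fix n
  have "fact n * fps_nth (f * g) n =
      (\<Sum>i=0..n. real (n choose i) * (fact i * fps_nth f i) * (fact (n - i) * fps_nth g (n - i)))"
    unfolding fps_mult_nth sum_distrib_left
    by (intro sum.cong) (auto simp: binomial_fact)
  also have "\<dots> \<in> \<nat>"
    using assms unfolding egf_integral_def
    by (intro sum_in_Nats Nats_mult[OF Nats_mult[OF of_nat_in_Nats]]) auto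
  finally show "fact n * fps_nth (f * g) n \<in> \<nat>" .
qed

lemma egf_integral_power: "egf_integral f \<Longrightarrow> egf_integral (f ^ a)"
proof (induction a)
  case 0
  show ?case by (simp add: egf_integral_def)
qed (simp add: egf_integral_mult)

text \<open>The natural factor is \<open>fact b\<close>; since it divides \<open>fact m\<close>, a
  single factorial serves all levels of a run.\<close>

lemma fact_level_weight_Nats: 
  assumes "b \<le> m" shows "fact m * level_weight j a b y \<in> \<nat>"
proof (cases "y \<le> a \<and> j * y \<le> b")
  case True
  have "egf_integral ((fps_const (1 / fact j) * fps_X ^ j) ^ y * tail_fps (Suc j) ^ (a - y))"
    by (rule egf_integral_mult[OF egf_integral_power egf_integral_power])
      (simp_all only: egf_integral_def monomial_nth tail_fps_nth, auto)
  then have "fact b * fps_nth ((fps_const (1 / fact j) * fps_X ^ j) ^ y * tail_fps (Suc j) ^ (a - y)) b \<in> \<nat>"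
    by (simp add: egf_integral_def)
  then have "real (a choose y) * (fact b * fps_nth ((fps_const (1 / fact j) * fps_X ^ j) ^ y * tail_fps (Suc j) ^ (a - y)) b) \<in> \<nat>"
    by (rule Nats_mult[OF of_nat_in_Nats])
  also have "real (a choose y) * (fact b * fps_nth ((fps_const (1 / fact j) * fps_X ^ j) ^ y * tail_fps (Suc j) ^ (a - y)) b)
      = fact b * level_weight j a b y"
    using True by (simp add: monomial_power_mult_nth level_weight_def configurations_def power_one_over)
  finally have *: "fact b * level_weight j a b y \<in> \<nat>" .
  obtain d where "(fact m :: nat) = fact b * d" using fact_dvd[OF assms] by (elim dvdE)
  then have "(fact m :: real) = real d * fact b" by (metis mult.commute of_nat_fact of_nat_mult)
  then show ?thesis using Nats_mult[OF of_nat_in_Nats[of d] *] by (simp add: mult_ac)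
next
  case False
  then show ?thesis by (auto simp: level_weight_def)
qed

section \<open>Inversion of a discrete distribution\<close>

text \<open>Inversion as a count of prefix sums instead of a least index, because a count is what
  the carries deliver. The prefix sums of nonnegative weights increase, so the two agree.\<close>

definition selected :: "(nat \<Rightarrow> real) \<Rightarrow> nat \<Rightarrow> real \<Rightarrow> nat" where
  "selected f a u = card {y. y \<le> a \<and> (\<Sum>i\<le>y. f i) \<le> u * (\<Sum>i\<le>a. f i)}"

text \<open>The relative position of the scaled u inside the interval that was hit: the randomness
  that the selection has not consumed.\<close>

definition rescaled :: "(nat \<Rightarrow> real) \<Rightarrow> nat \<Rightarrow> real \<Rightarrow> real" where
  "rescaled f a u = (let x = selected f a u in (u * (\<Sum>i\<le>a. f i) - (\<Sum>i<x. f i)) / f x)"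

text \<open>Connects the integers \<open>fact m * level_weight j a b y\<close>, with which the
  program computes, to the weights of the specification.\<close>

lemma selected_scale: "0 < c \<Longrightarrow> selected (\<lambda>y. c * f y) a u = selected f a u"
  by (simp add: selected_def mult.left_commute[of u] flip: sum_distrib_left)

lemma rescaled_scale: "0 < c \<Longrightarrow> rescaled (\<lambda>y. c * f y) a u = rescaled f a u"
  by (simp add: rescaled_def Let_def selected_scale mult.left_commute[of u] flip: sum_distrib_left right_diff_distrib)

lemma selected_props:
  fixes f :: "nat \<Rightarrow> real"
  assumes f: "\<And>y. 0 \<le> f y" and t: "0 < (\<Sum>i\<le>a. f i)" and u: "0 \<le> u" "u < 1"
  defines "x \<equiv> selected f a u"
  shows "x \<le> a" and "(\<Sum>i<x. f i) \<le> u * (\<Sum>i\<le>a. f i)" and "u * (\<Sum>i\<le>a. f i) < (\<Sum>i\<le>x. f i)"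
proof -
  define t where "t = u * (\<Sum>i\<le>a. f i)"
  have lt: "t < (\<Sum>i\<le>a. f i)" using u t by (simp add: t_def)
  have mono: "(\<Sum>i\<le>y. f i) \<le> (\<Sum>i\<le>z. f i)" if "y \<le> z" for y z
    using that f by (intro sum_mono2) auto
  define w where "w = (LEAST y. t < (\<Sum>i\<le>y. f i))"
  have w: "t < (\<Sum>i\<le>w. f i)" unfolding w_def by (rule LeastI[of _ a]) (rule lt)
  have wa: "w \<le> a" unfolding w_def by (rule Least_le) (rule lt)
  have less: "(\<Sum>i\<le>y. f i) \<le> t" if "y < w" for y
    using not_less_Least[of y "\<lambda>y. t < (\<Sum>i\<le>y. f i)"] that by (auto simp: w_def)
  have "{y. y \<le> a \<and> (\<Sum>i\<le>y. f i) \<le> t} = {..<w}"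
  proof (intro equalityI subsetI)
    fix y assume "y \<in> {y. y \<le> a \<and> (\<Sum>i\<le>y. f i) \<le> t}"
    then show "y \<in> {..<w}" using w mono[of w y] by (cases "w \<le> y") auto
  qed (use wa less in auto)
  then have x: "x = w" by (simp add: x_def selected_def t_def)
  show "x \<le> a" using wa x by simp
  show "u * (\<Sum>i\<le>a. f i) < (\<Sum>i\<le>x. f i)" using w x by (simp add: t_def)
  show "(\<Sum>i<x. f i) \<le> u * (\<Sum>i\<le>a. f i)"
  proof (cases x)
    case 0
    then show ?thesis using u t by simp
  next
    case (Suc y)
    then show ?thesis using less[of y] x by (simp add: t_def lessThan_Suc_atMost)
  qed
qed

lemma selected_weight_pos:
  fixes f :: "nat \<Rightarrow> real"
  assumes "\<And>y. 0 \<le> f y" "0 < (\<Sum>i\<le>a. f i)" "0 \<le> u" "u < 1"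
  shows "0 < f (selected f a u)"
  using selected_props(2,3)[OF assms] by (simp add: lessThan_Suc_atMost[symmetric])

lemma rescaled_bounds:
  fixes f :: "nat \<Rightarrow> real"
  assumes "\<And>y. 0 \<le> f y" "0 < (\<Sum>i\<le>a. f i)" "0 \<le> u" "u < 1"
  shows "0 \<le> rescaled f a u" and "rescaled f a u < 1"
  using selected_props(2,3)[OF assms] selected_weight_pos[OF assms]
  by (simp_all add: rescaled_def Let_def lessThan_Suc_atMost[symmetric])

lemma selected_unique:
  fixes f :: "nat \<Rightarrow> real"
  assumes f: "\<And>y. 0 \<le> f y" and t: "0 < (\<Sum>i\<le>a. f i)" and u: "0 \<le> u" "u < 1"
    and y: "(\<Sum>i<y. f i) \<le> u * (\<Sum>i\<le>a. f i)" "u * (\<Sum>i\<le>a. f i) < (\<Sum>i\<le>y. f i)"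
  shows "selected f a u = y"
proof -
  note s = selected_props[OF f t u]
  have mono: "(\<Sum>i\<le>y. f i) \<le> (\<Sum>i<z. f i)" if "y < z" for y z
    using that f by (intro sum_mono2) auto
  show ?thesis
    using mono[of y "selected f a u"] mono[of "selected f a u" y] s y
    by (cases y "selected f a u" rule: linorder_cases) auto
qed

section \<open>Digits, prefix sums and selection in positional notation\<close>

lemma sum_digits_less:
  fixes f :: "nat \<Rightarrow> nat"
  shows "(\<And>y. y < i \<Longrightarrow> f y < B) \<Longrightarrow> (\<Sum>y<i. f y * B ^ y) < B ^ i"
proof (induction i)
  case (Suc i)
  have "(\<Sum>y<Suc i. f y * B ^ y) < B ^ i + f i * B ^ i" using Suc by simp
  also have "\<dots> = Suc (f i) * B ^ i" by simp
  also have "\<dots> \<le> B * B ^ i" using Suc.prems[of i] by (intro mult_right_mono) auto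
  finally show ?case by simp
qed simp

lemma digit_of_sum:
  fixes f :: "nat \<Rightarrow> nat"
  assumes f: "\<And>y. y \<le> a \<Longrightarrow> f y < B" and i: "i \<le> a"
  shows "(\<Sum>y\<le>a. f y * B ^ y) div B ^ i mod B = f i"
proof -
  define L where "L = (\<Sum>y<i. f y * B ^ y)"
  define H where "H = (\<Sum>y\<in>{i<..a}. f y * B ^ (y - Suc i))"
  have L: "L < B ^ i" unfolding L_def using f i by (intro sum_digits_less) auto
  have "{..a} = {..<i} \<union> ({i} \<union> {i<..a})" using i by auto
  then have "(\<Sum>y\<le>a. f y * B ^ y) = L + (\<Sum>y\<in>{i} \<union> {i<..a}. f y * B ^ y)"
    unfolding L_def by (simp only:) (rule sum.union_disjoint, auto)
  also have "(\<Sum>y\<in>{i} \<union> {i<..a}. f y * B ^ y) = f i * B ^ i + (\<Sum>y\<in>{i<..a}. f y * B ^ y)"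
    by (subst sum.union_disjoint) auto
  also have "(\<Sum>y\<in>{i<..a}. f y * B ^ y) = B ^ i * (B * H)"
    unfolding H_def sum_distrib_left
  proof (rule sum.cong[OF refl])
    fix y assume "y \<in> {i<..a}"
    then have "B ^ y = B ^ i * (B * B ^ (y - Suc i))"
      by (metis Suc_diff_Suc greaterThanAtMost_iff le_add_diff_inverse less_imp_le power_Suc power_add)
    then show "f y * B ^ y = B ^ i * (B * (f y * B ^ (y - Suc i)))" by simp
  qed
  finally have "(\<Sum>y\<le>a. f y * B ^ y) = L + B ^ i * (f i + B * H)" by (simp add: algebra_simps)
  moreover have "0 < B" using f[OF i] by simp
  ultimately have "(\<Sum>y\<le>a. f y * B ^ y) div B ^ i = f i + B * H" using L by simp
  then show ?thesis using f[OF i] by simp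
qed

definition base_digit :: "real \<Rightarrow> real \<Rightarrow> real \<Rightarrow> real" where
  "base_digit B p x = rmod (of_int \<lfloor>p / B powr x\<rfloor>) B"

lemma base_digit_sum:
  fixes f :: "nat \<Rightarrow> nat"
  assumes "\<And>y. y \<le> a \<Longrightarrow> f y < B" "i \<le> a"
  shows "base_digit (real B) (real (\<Sum>y\<le>a. f y * B ^ y)) (real i) = real (f i)"
proof -
  have "0 < B" using assms by fastforce
  then have "real B powr real i = real (B ^ i)" by (simp add: powr_realpow)
  then show ?thesis
    unfolding base_digit_def
    by (simp only: floor_divide_of_nat_eq of_int_of_nat_eq rmod_of_nat digit_of_sum[OF assms])
qed

text \<open>Summation by parts: weight i occurs in the prefix sums from i to a and so contributes
  W_i * (B^(a+1) - B^i) / (B - 1). All prefix sums are thereby formed at once from the total t and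
  the packed weights g.\<close>

definition prefix_number :: "real \<Rightarrow> real \<Rightarrow> real \<Rightarrow> real \<Rightarrow> real" where
  "prefix_number B t g a = (B powr (a + 1) * t - g) / (B - 1)"

text \<open>To base \<open>B\<close>, the digits of \<open>p\<close> are the prefix sums of the weights, so digit \<open>i\<close> of \<open>y\<close> is at
  least \<open>h\<close> iff the \<open>i\<close>th prefix sum is at most \<open>u * t\<close>.  Kummer's theorem counts these digits as
  carries in \<open>y + z\<close>.\<close>

definition rselect :: "real \<Rightarrow> real \<Rightarrow> real \<Rightarrow> real \<Rightarrow> real \<Rightarrow> real \<Rightarrow> real" where
  "rselect h B t p a u = (let e = (B powr (a + 1) - 1) / (B - 1); z = h * e;
     y = (h + of_int \<lfloor>u * t\<rfloor>) * e - p in rtwoval (rbinomial (y + z) z))"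

lemma geometric_number:
  assumes "2 \<le> B"
  shows "(real B powr (real a + 1) - 1) / (real B - 1) = real (\<Sum>y\<le>a. B ^ y)"
proof -
  have "real B powr (real a + 1) = real B ^ Suc a"
    using assms powr_realpow[of "real B" "Suc a"] by (simp add: add.commute)
  moreover have "(real B - 1) * (\<Sum>y\<le>a. real B ^ y) = real B ^ Suc a - 1"
    using power_diff_1_eq[of "real B" "Suc a"] by (simp only: lessThan_Suc_atMost)
  ultimately show ?thesis using assms by (simp add: field_simps)
qed

lemma prefix_number_sum:
  fixes W :: "nat \<Rightarrow> nat"
  assumes "2 \<le> B"
  shows "prefix_number (real B) (real (\<Sum>y\<le>a. W y)) (real (\<Sum>y\<le>a. W y * B ^ y)) (real a)
    = real (\<Sum>y\<le>a. (\<Sum>i\<le>y. W i) * B ^ y)"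
proof -
  have "real B powr (real a + 1) = real B ^ Suc a"
    using assms powr_realpow[of "real B" "Suc a"] by (simp add: add.commute)
  moreover have "(real B - 1) * (\<Sum>y\<le>a. (\<Sum>i\<le>y. real (W i)) * real B ^ y)
      = real B ^ Suc a * (\<Sum>y\<le>a. real (W y)) - (\<Sum>y\<le>a. real (W y) * real B ^ y)"
    by (induction a) (simp_all add: algebra_simps)
  ultimately show ?thesis using assms by (simp add: prefix_number_def field_simps)
qed

text \<open>With r the floor of u * t, digit y of \<open>Y\<close> is h + r minus the prefix sum
  S_y. As r < t < h, all these digits lie in [0, 2 * h), so the packed subtraction never borrows and
  the base B = 4 * h leaves room for the carry. The digit is at least h iff S_y \<le> r, which for
  the integer S_y means S_y \<le> u * t.\<close>

lemma rselect_eq: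
  fixes W :: "nat \<Rightarrow> nat"
  assumes h: "h = 2 ^ k" and B: "B = 2 ^ (k + 2)" and t: "t = (\<Sum>y\<le>a. W y)" "0 < t" "t < h"
    and u: "0 \<le> u" "u < 1"
  shows "rselect (real h) (real B) (real t) (real (\<Sum>y\<le>a. (\<Sum>i\<le>y. W i) * B ^ y)) (real a) u
    = real (selected (\<lambda>y. real (W y)) a u)"
proof -
  define r where "r = nat \<lfloor>u * t\<rfloor>"
  have "0 \<le> \<lfloor>u * real t\<rfloor>" using u by simp
  then have r: "of_int \<lfloor>u * real t\<rfloor> = real r" unfolding r_def by (metis of_int_of_nat_eq nat_0_le)
  have "u * real t < 1 * real t" using u t(2) by (intro mult_strict_right_mono) auto
  then have rt: "r < t" using of_int_floor_le[of "u * real t"] unfolding r by linarith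
  \<comment> \<open>The cap at a gives \<open>S y \<le> t\<close> for every y, so the natural
    subtraction in \<open>f\<close> is never truncated.\<close>
  define S where "S = (\<lambda>y. \<Sum>i\<le>min y a. W i)"
  have S: "S y \<le> t" for y unfolding S_def t by (rule sum_mono2) auto
  define f where "f = (\<lambda>y. h + r - S y)"
  have f: "f y < 2 ^ Suc k" for y
    using rt t S[of y] by (simp add: f_def h)
  have B2: "2 \<le> B" unfolding B by (simp add: power_add)
  define Y where "Y = (\<Sum>y\<le>a. f y * B ^ y)"
  define Z where "Z = (\<Sum>y\<le>a. h * B ^ y)"
  have "Y + (\<Sum>y\<le>a. S y * B ^ y) = (\<Sum>y\<le>a. (h + r) * B ^ y)"
    unfolding Y_def sum.distrib[symmetric]
  proof (rule sum.cong[OF refl])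
    fix y show "f y * B ^ y + S y * B ^ y = (h + r) * B ^ y"
      using S[of y] t by (simp add: f_def flip: distrib_right)
  qed
  moreover have "(\<Sum>y\<le>a. S y * B ^ y) = (\<Sum>y\<le>a. (\<Sum>i\<le>y. W i) * B ^ y)"
    by (intro sum.cong) (auto simp: S_def min_def)
  ultimately have Y: "(real h + real r) * real (\<Sum>y\<le>a. B ^ y) - real (\<Sum>y\<le>a. (\<Sum>i\<le>y. W i) * B ^ y) = real Y"
    by (simp add: sum_distrib_left of_nat_add[symmetric] of_nat_mult[symmetric] del: of_nat_add of_nat_mult of_nat_sum)
  have Z: "real h * real (\<Sum>y\<le>a. B ^ y) = real Z" by (simp add: Z_def sum_distrib_left)
  have "rselect (real h) (real B) (real t) (real (\<Sum>y\<le>a. (\<Sum>i\<le>y. W i) * B ^ y)) (real a) u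
      = rtwoval (real ((Y + Z) choose Z))"
    unfolding rselect_def Let_def r geometric_number[OF B2] Y Z
    by (simp only: of_nat_add[symmetric] rbinomial_of_nat)
  also have "\<dots> = real (multiplicity 2 ((Y + Z) choose Z))"
    by (rule rtwoval_of_nat) simp
  also have "multiplicity 2 ((Y + Z) choose Z) = card {y. y \<le> a \<and> 2 ^ k \<le> f y}"
    unfolding Y_def Z_def B h by (rule multiplicity_2_binomial_digits) (rule f)
  also have "{y. y \<le> a \<and> 2 ^ k \<le> f y} = {y. y \<le> a \<and> (\<Sum>i\<le>y. real (W i)) \<le> u * (\<Sum>i\<le>a. real (W i))}"
  proof (intro Collect_cong conj_cong refl)
    fix y assume y: "y \<le> a"
    have "2 ^ k \<le> f y \<longleftrightarrow> S y \<le> r" using S[of y] t by (auto simp: f_def h)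
    also have "\<dots> \<longleftrightarrow> real (S y) \<le> u * real t"
      using u unfolding r_def by (simp add: le_nat_iff le_floor_iff)
    finally show "2 ^ k \<le> f y \<longleftrightarrow> (\<Sum>i\<le>y. real (W i)) \<le> u * (\<Sum>i\<le>a. real (W i))"
      using y by (simp add: S_def t min_def)
  qed
  finally show ?thesis by (simp add: selected_def)
qed

section \<open>Sampling level by level\<close>

definition integer_weight :: "nat \<Rightarrow> nat \<Rightarrow> nat \<Rightarrow> nat \<Rightarrow> nat \<Rightarrow> nat" where
  "integer_weight m j a b y = nat \<lfloor>fact m * level_weight j a b y\<rfloor>"

lemma real_integer_weight:
  "b \<le> m \<Longrightarrow> real (integer_weight m j a b y) = fact m * level_weight j a b y"
  using fact_level_weight_Nats[of b m j a y] by (auto simp: integer_weight_def elim: Nats_cases)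

text \<open>One modulus q works for all levels and for every \<beta> up to B, since the series at 1
  is at most \<open>fact m * (3 * B) ^ n\<close>. The coefficients are integers up to index b
  because b \<le> m; this is as far as \<open>series_digit\<close> asks for.\<close>

lemma level_digit:
  fixes n m j a b \<beta> B q :: nat
  assumes a: "a \<le> n" and b: "b \<le> m" and \<beta>: "1 \<le> \<beta>" "\<beta> \<le> B"
    and q: "q = fact m * (3 * B) ^ n + 1"
  shows "series_digit (fact m * eval_fps (marked_fps (real \<beta>) j) (1 / q) ^ a) (real q) (real b)
    = real (\<Sum>y\<le>a. integer_weight m j a b y * \<beta> ^ y)"
proof (rule series_digit)
  let ?f = "marked_fps (real \<beta>) j"
  show "(\<lambda>i. (fact m * fps_nth (?f ^ a) i) * (1 / real q) ^ i) sums (fact m * eval_fps ?f (1 / q) ^ a)"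
    using sums_mult[OF sums_eval_power[of ?f a "1 / real q"], of "fact m"] by (simp add: mult.assoc)
  show "(\<lambda>i. fact m * fps_nth (?f ^ a) i) sums (fact m * eval_fps ?f 1 ^ a)"
    using sums_mult[OF sums_eval_power[of ?f a 1], of "fact m"] by simp
  show nn: "0 \<le> fact m * fps_nth (?f ^ a) i" for i
    by (auto simp: marked_power_nth intro!: sum_nonneg mult_nonneg_nonneg level_weight_nonneg)
  show "fact m * fps_nth (?f ^ a) i = real (\<Sum>y\<le>a. integer_weight m j a i y * \<beta> ^ y)" if "i \<le> b" for i
    using that b by (simp add: marked_power_nth real_integer_weight sum_distrib_left mult.assoc)
  have nn1: "0 \<le> eval_fps ?f 1" by (simp add: eval_marked eval_tail_nonneg)
  have "eval_fps ?f 1 ^ a \<le> (3 * real \<beta>) ^ a"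
    using nn1 \<beta> by (intro power_mono eval_marked_le) auto
  also have "\<dots> \<le> (3 * real B) ^ a" using \<beta> by (intro power_mono) auto
  also have "\<dots> \<le> (3 * real B) ^ n" using a \<beta> by (intro power_increasing) auto
  finally have "fact m * eval_fps ?f 1 ^ a \<le> fact m * (3 * real B) ^ n" by simp
  also have "\<dots> < real q" by (simp add: q)
  finally show "fact m * eval_fps ?f 1 ^ a < real q" .
qed

lemma sum_integer_weight:
  "b \<le> m \<Longrightarrow> real (\<Sum>y\<le>a. integer_weight m j a b y) = fact m * configurations j a b"
  by (simp add: real_integer_weight sum_level_weight flip: sum_distrib_left)

text \<open>Provides a power of two above the total weight whose exponent is a plain arithmetic
  expression: the configurations contribute at most 3^a \<le> 4^n, and \<open>fact m\<close> is
  below 2 to the power \<open>fact m\<close>.\<close>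

lemma sum_integer_weight_less:
  assumes a: "a \<le> n" and b: "b \<le> m"
  shows "(\<Sum>y\<le>a. integer_weight m j a b y) < 2 ^ (fact m + 2 * n)"
proof -
  have sums: "(\<lambda>i. configurations j a i) sums (eval_fps (tail_fps j) 1 ^ a)"
    using sums_eval_power[of "tail_fps j" a 1] by (simp add: configurations_def)
  have "(\<Sum>i\<in>{b}. configurations j a i) \<le> suminf (configurations j a)"
    using sums by (intro sum_le_suminf) (auto simp: configurations_nonneg sums_iff)
  then have "configurations j a b \<le> eval_fps (tail_fps j) 1 ^ a"
    using sums by (simp add: sums_iff)
  also have "\<dots> \<le> 3 ^ a" by (intro power_mono eval_tail_le eval_tail_nonneg) simp
  also have "\<dots> \<le> 4 ^ a" by (intro power_mono) auto
  also have "\<dots> \<le> 4 ^ n" using a by (intro power_increasing) auto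
  finally have "fact m * configurations j a b \<le> fact m * (4 ^ n :: real)" by simp
  also have "\<dots> < real (2 ^ fact m) * 4 ^ n"
    using less_exp[of "fact m"] by (intro mult_strict_right_mono) (metis of_nat_fact of_nat_less_iff, simp)
  also have "\<dots> = real (2 ^ (fact m + 2 * n))" by (simp add: power_add power_mult)
  finally show ?thesis using sum_integer_weight[OF b, of j a] by linarith
qed

text \<open>Specification of the loop: a bins with at least j balls each remain, and b balls lie in
  them. The test \<open>b < j\<close> makes the recursion terminate for arbitrary arguments.\<close>

function bins_from :: "nat \<Rightarrow> nat \<Rightarrow> nat \<Rightarrow> real \<Rightarrow> nat list" where
  "bins_from j a b u = (if a = 0 \<or> b < j then [] else
     let x = selected (level_weight j a b) a u
     in x # bins_from (Suc j) (a - x) (b - j * x) (rescaled (level_weight j a b) a u))"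
  by pat_completeness auto
termination by (relation "Wellfounded.measure (\<lambda>(j, a, b, u). Suc b - j)") auto

declare bins_from.simps [simp del]

text \<open>The invariant \<open>0 < configurations j a b\<close> says that the remaining balls can
  still be placed. It persists because inversion never selects a value of weight 0, and it forces j
  \<le> b while bins remain.\<close>

lemma bins_from_step:
  assumes a: "0 < a" and c: "0 < configurations j a b" and u: "0 \<le> u" "u < 1"
  defines "x \<equiv> selected (level_weight j a b) a u" and "v \<equiv> rescaled (level_weight j a b) a u"
  shows "bins_from j a b u = x # bins_from (Suc j) (a - x) (b - j * x) v"
    and "j \<le> b" and "x \<le> a" and "j * x \<le> b" and "0 < level_weight j a b x"
    and "0 < configurations (Suc j) (a - x) (b - j * x)" and "0 \<le> v" and "v < 1"
proof -
  have "j \<le> j * a" using a by simp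
  then show jb: "j \<le> b" using configurations_le_pos[OF c] by (rule order.trans)
  then show "bins_from j a b u = x # bins_from (Suc j) (a - x) (b - j * x) v"
    using a by (subst bins_from.simps) (simp add: x_def v_def Let_def)
  have t: "0 < (\<Sum>i\<le>a. level_weight j a b i)" using c by (simp add: sum_level_weight)
  note lw = level_weight_nonneg[of j a b]
  show pos: "0 < level_weight j a b x"
    unfolding x_def by (rule selected_weight_pos[OF lw t u])
  then show "x \<le> a" "j * x \<le> b" by (auto simp: level_weight_def split: if_splits)
  have "configurations (Suc j) (a - x) (b - j * x) \<noteq> 0"
    using pos by (auto simp: level_weight_def split: if_splits)
  then show "0 < configurations (Suc j) (a - x) (b - j * x)"
    using configurations_nonneg[of "Suc j" "a - x" "b - j * x"] by simp
  show "0 \<le> v" "v < 1" unfolding v_def by (rule rescaled_bounds[OF lw t u])+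
qed

text \<open>\<open>fact b\<close> times this number counts the placements with exactly
  \<open>xs ! i\<close> bins of j + i balls. Requiring bins to remain before each entry and none at
  the end excludes trailing zeros.\<close>

fun outcome_weight :: "nat \<Rightarrow> nat \<Rightarrow> nat \<Rightarrow> nat list \<Rightarrow> real" where
  "outcome_weight j a b [] = (if a = 0 \<and> b = 0 then 1 else 0)"
| "outcome_weight j a b (x # xs) = (if 0 < a \<and> x \<le> a \<and> j * x \<le> b
     then real (a choose x) / fact j ^ x * outcome_weight (Suc j) (a - x) (b - j * x) xs else 0)"

lemma outcome_weight_nonneg: "0 \<le> outcome_weight j a b xs"
  by (induction xs arbitrary: j a b) auto

lemma outcome_weight_le: "outcome_weight j a b xs \<le> configurations j a b"
proof (induction xs arbitrary: j a b)
  case Nil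
  then show ?case using configurations_nonneg[of j a b] by (auto simp: configurations_0)
next
  case (Cons x xs)
  show ?case
  proof (cases "0 < a \<and> x \<le> a \<and> j * x \<le> b")
    case True
    have "outcome_weight j a b (x # xs) \<le> level_weight j a b x"
      using True Cons by (auto simp: level_weight_def intro!: mult_left_mono divide_right_mono)
    also have "\<dots> \<le> (\<Sum>y\<le>a. level_weight j a b y)"
      using True by (intro member_le_sum) (auto simp: level_weight_nonneg)
    finally show ?thesis by (simp add: sum_level_weight)
  next
    case False
    then show ?thesis using configurations_nonneg[of j a b] by auto
  qed
qed

text \<open>The randomness left over after each level is again uniform, so the outcome is decided by the
  interval containing \<open>u\<close>.\<close>

lemma bins_from_interval:
  assumes "0 < configurations j a b"
  shows "\<exists>l. \<forall>u. 0 \<le> u \<and> u < 1 \<and> bins_from j a b u = xs \<longleftrightarrow>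
    l \<le> u \<and> u < l + outcome_weight j a b xs / configurations j a b"
  using assms
proof (induction xs arbitrary: j a b)
  case Nil
  show ?case
  proof (cases "a = 0")
    case True
    with Nil have "b = 0" by (auto simp: configurations_0 split: if_splits)
    with True show ?thesis
      by (intro exI[of _ 0]) (auto simp: configurations_0 bins_from.simps)
  next
    case False
    then show ?thesis using bins_from_step(1)[of a j b] Nil by (intro exI[of _ 0]) auto
  qed
next
  case (Cons x xs)
  let ?lw = "level_weight j a b"
  let ?S = "\<Sum>i<x. ?lw i"
  let ?c = "configurations j a b"
  have t: "(\<Sum>i\<le>a. ?lw i) = ?c" by (rule sum_level_weight)
  have t0: "0 < (\<Sum>i\<le>a. ?lw i)" using Cons.prems t by simp
  note lw = level_weight_nonneg[of j a b]
  show ?case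
  proof (cases "0 < a \<and> 0 < ?lw x")
    case False
    have "outcome_weight j a b (x # xs) = 0"
    proof (rule ccontr)
      assume *: "outcome_weight j a b (x # xs) \<noteq> 0"
      then have r: "0 < a" "x \<le> a" "j * x \<le> b" by (auto split: if_splits)
      then have "?lw x = 0" using False lw[of x] by auto
      then have "configurations (Suc j) (a - x) (b - j * x) = 0"
        using r by (auto simp: level_weight_def)
      then have "outcome_weight (Suc j) (a - x) (b - j * x) xs = 0"
        using outcome_weight_le[of "Suc j" "a - x" "b - j * x" xs]
          outcome_weight_nonneg[of "Suc j" "a - x" "b - j * x" xs] by simp
      then show False using * r by simp
    qed
    moreover have "bins_from j a b u \<noteq> x # xs" if "0 \<le> u" "u < 1" for u
      using False bins_from_step(1,5)[OF _ Cons.prems that] by (cases "a = 0") (auto simp: bins_from.simps[of j 0])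
    ultimately show ?thesis by (intro exI[of _ 0]) auto
  next
    case True
    then have a: "0 < a" and W: "0 < ?lw x" by auto
    have r: "x \<le> a" "j * x \<le> b" using W by (auto simp: level_weight_def split: if_splits)
    let ?c' = "configurations (Suc j) (a - x) (b - j * x)"
    let ?o = "outcome_weight (Suc j) (a - x) (b - j * x) xs"
    have "?c' \<noteq> 0" using W by (auto simp: level_weight_def split: if_splits)
    then have c': "0 < ?c'" using configurations_nonneg[of "Suc j" "a - x" "b - j * x"] by simp
    from Cons.IH[OF c'] obtain l where l: "\<And>u. 0 \<le> u \<and> u < 1 \<and> bins_from (Suc j) (a - x) (b - j * x) u = xs
        \<longleftrightarrow> l \<le> u \<and> u < l + ?o / ?c'" by blast
    have S1: "0 \<le> ?S" "?S + ?lw x \<le> ?c"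
      using sum_mono2[of "{..a}" "{..x}" ?lw] lw r t
      by (auto simp: sum_nonneg lessThan_Suc_atMost[symmetric])
    have c: "0 < ?c" by (rule Cons.prems)
    define v where "v = (\<lambda>u. (u * ?c - ?S) / ?lw x)"
    have ow: "outcome_weight j a b (x # xs) = ?lw x * (?o / ?c')"
      using a r c' by (simp add: level_weight_def)
    have iff: "0 \<le> u \<and> u < 1 \<and> bins_from j a b u = x # xs \<longleftrightarrow>
        0 \<le> v u \<and> v u < 1 \<and> bins_from (Suc j) (a - x) (b - j * x) (v u) = xs" (is "?L \<longleftrightarrow> ?R") for u
    proof
      assume ?L
      note u = \<open>?L\<close>
      note s = bins_from_step[OF a Cons.prems conjunct1[OF u] conjunct1[OF conjunct2[OF u]]]
      from s(1) u have x: "selected ?lw a u = x" by simp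
      then have "v u = rescaled ?lw a u" by (simp add: v_def rescaled_def Let_def t)
      with s x u show ?R by simp
    next
      assume R: ?R
      then have ge: "?S \<le> u * ?c" and lt: "u * ?c < ?S + ?lw x"
        using W by (auto simp: v_def field_simps)
      have "0 \<le> u * ?c" using ge S1 by simp
      then have u0: "0 \<le> u" using c by (simp add: zero_le_mult_iff)
      have "u * ?c < 1 * ?c" using lt S1 by simp
      then have u1: "u < 1" using c by simp
      have x: "selected ?lw a u = x"
        using ge lt unfolding t[symmetric]
        by (intro selected_unique[OF lw t0 u0 u1]) (simp_all only: lessThan_Suc_atMost[symmetric] sum.lessThan_Suc)
      then have "v u = rescaled ?lw a u" by (simp add: v_def rescaled_def Let_def t)
      with bins_from_step(1)[OF a Cons.prems u0 u1] x R u0 u1 show ?L by simp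
    qed
    show ?thesis
    \<comment> \<open>The left end is the preimage of l under the affine map \<open>v\<close>.
      Pulling back multiplies lengths by \<open>?lw x / ?c\<close>, and the factor
      \<open>?c'\<close> contained in \<open>?lw x\<close> cancels, which leaves the ratio for the
      longer list.\<close>
    proof (intro exI[of _ "(?S + ?lw x * l) / ?c"] allI)
      fix u
      have "0 \<le> u \<and> u < 1 \<and> bins_from j a b u = x # xs \<longleftrightarrow> l \<le> v u \<and> v u < l + ?o / ?c'"
        unfolding iff l ..
      also have "l \<le> v u \<longleftrightarrow> (?S + ?lw x * l) / ?c \<le> u"
        using W c by (simp add: v_def field_simps)
      also have "v u < l + ?o / ?c' \<longleftrightarrow> u * ?c < ?S + ?lw x * l + ?lw x * (?o / ?c')"
        using W by (simp only: v_def pos_divide_less_eq distrib_right distrib_left) (simp add: algebra_simps less_diff_eq)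
      also have "\<dots> \<longleftrightarrow> u < (?S + ?lw x * l) / ?c + outcome_weight j a b (x # xs) / ?c"
        unfolding ow add_divide_distrib[symmetric] using c by (simp only: pos_less_divide_eq)
      finally show "0 \<le> u \<and> u < 1 \<and> bins_from j a b u = x # xs \<longleftrightarrow> (?S + ?lw x * l) / ?c \<le> u \<and>
          u < (?S + ?lw x * l) / ?c + outcome_weight j a b (x # xs) / ?c" .
    qed
  qed
qed

section \<open>The program\<close>

definition mod_expr :: "expr \<Rightarrow> expr \<Rightarrow> expr" where
  "mod_expr p q = Binary Sub p (Binary Mul q (Unary Floor (Binary Div p q)))"

definition series_digit_expr :: "expr \<Rightarrow> expr \<Rightarrow> expr \<Rightarrow> expr" where
  "series_digit_expr f q k = mod_expr (Unary Floor (Binary Mul f (Binary Pow q k))) q"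

definition binomial_expr :: "expr \<Rightarrow> expr \<Rightarrow> expr" where
  "binomial_expr n k = (let q = Binary Add (Binary Pow (Const 2) n) (Const 1)
     in series_digit_expr (Binary Pow (Binary Add (Const 1) (Binary Div (Const 1) q)) n) q k)"

definition fact_expr :: "expr \<Rightarrow> expr" where
  "fact_expr m = (let r = Binary Mul (Binary Mul (Binary Mul (Const 2) m) m) (Binary Add (Binary Pow m m) (Const 1))
     in Unary Floor (Binary Div (Binary Pow r m) (binomial_expr r m)))"

definition twoval_expr :: "expr \<Rightarrow> expr" where
  "twoval_expr n = (let p = Binary Pow (Const 2) n;
      q = Binary Add (Binary Mul (Binary Add n (Const 1)) (Binary Add p (Const 1))) (Const 1);
      a = Binary Pow (Binary Div (Const 1) q) n; b = Binary Pow (Binary Div (Const 1) q) p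
    in Binary Div (Unary Ln (Binary Sub (series_digit_expr (Binary Mul
        (Binary Div (Binary Sub (Const 1) (Binary Pow a (Binary Add p (Const 1)))) (Binary Sub (Const 1) a))
        (Binary Div (Binary Sub (Const 1) (Binary Pow b (Binary Add n (Const 1)))) (Binary Sub (Const 1) b)))
        q (Binary Mul n p)) (Const 1))) (Unary Ln (Const 2)))"

definition base_digit_expr :: "expr \<Rightarrow> expr \<Rightarrow> expr \<Rightarrow> expr" where
  "base_digit_expr B p x = mod_expr (Unary Floor (Binary Div p (Binary Pow B x))) B"

definition prefix_expr :: "expr \<Rightarrow> expr \<Rightarrow> expr \<Rightarrow> expr \<Rightarrow> expr" where
  "prefix_expr B t g a = Binary Div
     (Binary Sub (Binary Mul (Binary Pow B (Binary Add a (Const 1))) t) g) (Binary Sub B (Const 1))"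

definition select_expr :: "expr \<Rightarrow> expr \<Rightarrow> expr \<Rightarrow> expr \<Rightarrow> expr \<Rightarrow> expr \<Rightarrow> expr" where
  "select_expr h B t p a u = (let
      e = Binary Div (Binary Sub (Binary Pow B (Binary Add a (Const 1))) (Const 1)) (Binary Sub B (Const 1));
      z = Binary Mul h e;
      y = Binary Sub (Binary Mul (Binary Add h (Unary Floor (Binary Mul u t))) e) p
    in twoval_expr (binomial_expr (Binary Add y z) z))"

lemma mod_expr_val [simp]: "expr_val (mod_expr p q) M = rmod (expr_val p M) (expr_val q M)"
  by (simp add: mod_expr_def rmod_def)

lemma series_digit_expr_val [simp]:
  "expr_val (series_digit_expr f q k) M = series_digit (expr_val f M) (expr_val q M) (expr_val k M)"
  by (simp add: series_digit_expr_def series_digit_def)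

lemma binomial_expr_val [simp]:
  "expr_val (binomial_expr n k) M = rbinomial (expr_val n M) (expr_val k M)"
  by (simp add: binomial_expr_def rbinomial_def Let_def)

lemma fact_expr_val [simp]: "expr_val (fact_expr m) M = rfact (expr_val m M)"
  by (simp add: fact_expr_def rfact_def Let_def)

lemma twoval_expr_val [simp]: "expr_val (twoval_expr n) M = rtwoval (expr_val n M)"
  by (simp add: twoval_expr_def rtwoval_def Let_def)

lemma base_digit_expr_val [simp]:
  "expr_val (base_digit_expr B p x) M = base_digit (expr_val B M) (expr_val p M) (expr_val x M)"
  by (simp add: base_digit_expr_def base_digit_def)

lemma prefix_expr_val [simp]:
  "expr_val (prefix_expr B t g a) M = prefix_number (expr_val B M) (expr_val t M) (expr_val g M) (expr_val a M)"
  by (simp add: prefix_expr_def prefix_number_def)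

lemma select_expr_val [simp]:
  "expr_val (select_expr h B t p a u) M =
    rselect (expr_val h M) (expr_val B M) (expr_val t M) (expr_val p M) (expr_val a M) (expr_val u M)"
  by (simp add: select_expr_def rselect_def Let_def)

lemma address_of_nat [simp]: "address (real k) = k"
  by (simp add: address_def)

text \<open>The program keeps its variables in the registers from \<open>m + 2\<close> on, out of the way of the
  output, and the address \<open>m + 2\<close> in register 0.\<close>

definition var_address :: "nat \<Rightarrow> expr" where
  "var_address i = Binary Add (Load (Const 0)) (Const (int i))"

abbreviation var :: "nat \<Rightarrow> expr" where
  "var i \<equiv> Load (var_address i)"

text \<open>\<open>ws\<close> is the output written so far and \<open>v\<close> gives the variables
  relative to \<open>base\<close>; \<open>length ws < base\<close> keeps the two regions
  apart.\<close>

definition frame :: "nat \<Rightarrow> real list \<Rightarrow> (nat \<Rightarrow> real) \<Rightarrow> memory \<Rightarrow> bool" where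
  "frame base ws v M \<longleftrightarrow> length ws < base \<and> M 0 = real base \<and> (\<forall>i. M (base + i) = v i) \<and>
     (\<forall>i<length ws. M (Suc i) = ws ! i)"

lemma var_address_val: "frame base ws v M \<Longrightarrow> address (expr_val (var_address i) M) = base + i"
proof -
  assume "frame base ws v M"
  then have "expr_val (var_address i) M = real (base + i)" 
    using address_of_nat[of 0] by (simp add: frame_def var_address_def del: address_of_nat)
  then show ?thesis by (simp only: address_of_nat)
qed

lemma var_val: "frame base ws v M \<Longrightarrow> expr_val (var i) M = v i"
  by (simp add: var_address_val) (simp add: frame_def)

section \<open>Correctness and exact cost of straight-line code\<close>

fun straight_cost :: "cmd \<Rightarrow> nat" where
  "straight_cost (Store a e) = 1 + expr_cost a + expr_cost e"
| "straight_cost (Sample a) = 1 + expr_cost a"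
| "straight_cost (Seq c d) = straight_cost c + straight_cost d"
| "straight_cost _ = 1"

text \<open>A total correctness triple with exact cost that leaves the random stream untouched;
  sampling and the loop are therefore treated separately.\<close>

definition transforms :: "(memory \<Rightarrow> bool) \<Rightarrow> cmd \<Rightarrow> (memory \<Rightarrow> bool) \<Rightarrow> bool" where
  "transforms P c Q \<longleftrightarrow> (\<forall>M \<omega>. P M \<longrightarrow> (\<exists>M'. exec c (M, \<omega>) (straight_cost c) (M', \<omega>) \<and> Q M'))"

lemma transforms_Seq: "transforms P c Q \<Longrightarrow> transforms Q d R \<Longrightarrow> transforms P (Seq c d) R"
  unfolding transforms_def by (metis exec.Seq straight_cost.simps(3))

lemma transforms_assign:
  assumes "\<And>M. frame base ws v M \<Longrightarrow> expr_val e M = x"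
  shows "transforms (frame base ws v) (Store (var_address i) e) (frame base ws (v(i := x)))"
  unfolding transforms_def
proof (intro allI impI)
  fix M and \<omega> :: "real stream"
  assume M: "frame base ws v M"
  have "exec (Store (var_address i) e) (M, \<omega>) (straight_cost (Store (var_address i) e)) (M(base + i := x), \<omega>)"
    using exec.Store[of "var_address i" e M \<omega>] by (simp add: var_address_val[OF M] assms[OF M])
  moreover have "frame base ws (v(i := x)) (M(base + i := x))"
    using M by (auto simp: frame_def)
  ultimately show "\<exists>M'. exec (Store (var_address i) e) (M, \<omega>) (straight_cost (Store (var_address i) e)) (M', \<omega>) \<and>
      frame base ws (v(i := x)) M'" by blast
qed

lemma transforms_output:
  assumes p: "\<And>M. frame base ws v M \<Longrightarrow> expr_val p M = real (Suc (length ws))"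
    and e: "\<And>M. frame base ws v M \<Longrightarrow> expr_val e M = x" and l: "Suc (length ws) < base"
  shows "transforms (frame base ws v) (Store p e) (frame base (ws @ [x]) v)"
  unfolding transforms_def
proof (intro allI impI)
  fix M and \<omega> :: "real stream"
  assume M: "frame base ws v M"
  have "exec (Store p e) (M, \<omega>) (straight_cost (Store p e)) (M(Suc (length ws) := x), \<omega>)"
    using exec.Store[of p e M \<omega>] by (simp only: p[OF M] e[OF M] address_of_nat straight_cost.simps)
  moreover have "frame base (ws @ [x]) v (M(Suc (length ws) := x))"
    using M l by (auto simp: frame_def nth_append)
  ultimately show "\<exists>M'. exec (Store p e) (M, \<omega>) (straight_cost (Store p e)) (M', \<omega>) \<and> frame base (ws @ [x]) v M'"
    by blast
qed

text \<open>Variables: 0 bins left, 1 balls left, 2 \<open>fact m\<close>, 3 \<open>h\<close>, 4 the inverse of the evaluation point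
  \<open>z\<close>, 5 the tail of the exponential series at \<open>z\<close>, 6 the next term of that series, 7 remaining
  randomness, 8 level, 9 total weight, 10 and 11 the level weights and their prefix sums as digits to
  base \<open>4 * h\<close>, 12 the number of bins of the current level.\<close>

definition init_cmd :: cmd where
  "init_cmd = Seq (Store (var_address 2) (fact_expr (var 1)))
    (Seq (Store (var_address 3) (Binary Pow (Const 2) (Binary Add (var 2) (Binary Mul (Const 2) (var 0)))))
    (Seq (Store (var_address 4) (Binary Add (Binary Mul (var 2)
       (Binary Pow (Binary Mul (Const 12) (var 3)) (var 0))) (Const 1)))
    (Seq (Store (var_address 5) (Unary Exp (Binary Div (Const 1) (var 4))))
    (Seq (Store (var_address 6) (Const 1))
    (Seq (Store (var_address 7) (Binary Sub (var 7) (Unary Floor (var 7))))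
    (Store (var_address 8) (Const 0)))))))"

text \<open>The total is read while variable 5 still holds the tail from j; the packed weights need
  the tail from j + 1, so the subtraction comes between them. Likewise the level is incremented
  before the term of the series is updated, whose new divisor is j + 1.\<close>

definition level_cmd :: cmd where
  "level_cmd = Seq (Store (var_address 9)
       (series_digit_expr (Binary Mul (var 2) (Binary Pow (var 5) (var 0))) (var 4) (var 1)))
    (Seq (Store (var_address 5) (Binary Sub (var 5) (var 6)))
    (Seq (Store (var_address 10) (series_digit_expr (Binary Mul (var 2) (Binary Pow
       (Binary Add (Binary Mul (Binary Mul (Const 4) (var 3)) (var 6)) (var 5)) (var 0))) (var 4) (var 1)))
    (Seq (Store (var_address 11) (prefix_expr (Binary Mul (Const 4) (var 3)) (var 9) (var 10) (var 0)))
    (Seq (Store (var_address 12)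
       (select_expr (var 3) (Binary Mul (Const 4) (var 3)) (var 9) (var 11) (var 0) (var 7)))
    (Seq (Store (Binary Add (var 8) (Const 1)) (var 12))
    (Seq (Store (var_address 7) (let w = base_digit_expr (Binary Mul (Const 4) (var 3)) (var 10) (var 12)
       in Binary Div (Binary Sub (Binary Mul (var 7) (var 9))
         (Binary Sub (base_digit_expr (Binary Mul (Const 4) (var 3)) (var 11) (var 12)) w)) w))
    (Seq (Store (var_address 0) (Binary Sub (var 0) (var 12)))
    (Seq (Store (var_address 1) (Binary Sub (var 1) (Binary Mul (var 8) (var 12))))
    (Seq (Store (var_address 8) (Binary Add (var 8) (Const 1)))
    (Store (var_address 6) (Binary Div (Binary Div (var 6) (var 4)) (var 8))))))))))))"

definition level_test :: test where
  "level_test = Less (Const 0) (var 0)"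

text \<open>The q of \<open>level_digit\<close> for B = 4 * h with h = 2^(fact m + 2 * n); the
  program writes 3 * B as 12 * h.\<close>

definition modulus :: "nat \<Rightarrow> nat \<Rightarrow> nat" where
  "modulus n m = fact m * (3 * 2 ^ (fact m + 2 * n + 2)) ^ n + 1"

definition level_vars :: "nat \<Rightarrow> nat \<Rightarrow> nat \<Rightarrow> nat \<Rightarrow> nat \<Rightarrow> real \<Rightarrow> (nat \<Rightarrow> real) \<Rightarrow> bool" where
  "level_vars n m j a b u v \<longleftrightarrow> v 0 = real a \<and> v 1 = real b \<and> v 2 = fact m \<and>
     v 3 = real (2 ^ (fact m + 2 * n)) \<and> v 4 = real (modulus n m) \<and>
     v 5 = eval_fps (tail_fps j) (1 / modulus n m) \<and> v 6 = (1 / modulus n m) ^ j / fact j \<and>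
     v 7 = u \<and> v 8 = real j"

lemma level_cmd_transforms:
  assumes a: "0 < a" "a \<le> n" and b: "b \<le> m" and c: "0 < configurations j a b" and u: "0 \<le> u" "u < 1"
    and ws: "length ws = j" and v: "level_vars n m j a b u v"
  defines "x \<equiv> selected (level_weight j a b) a u"
  shows "\<exists>v'. level_vars n m (Suc j) (a - x) (b - j * x) (rescaled (level_weight j a b) a u) v' \<and>
    transforms (frame (m + 2) ws v) level_cmd (frame (m + 2) (ws @ [real x]) v')"
proof -
  define q where "q = modulus n m"
  define k where "k = fact m + 2 * n"
  define h :: nat where "h = 2 ^ k"
  define B :: nat where "B = 2 ^ (k + 2)"
  define W where "W = integer_weight m j a b"
  define t where "t = (\<Sum>y\<le>a. W y)"
  define z where "z = 1 / real q"
  define G where "G = (\<Sum>y\<le>a. W y * B ^ y)"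
  define P where "P = (\<Sum>y\<le>a. (\<Sum>i\<le>y. W i) * B ^ y)"
  note step = bins_from_step[OF a(1) c u, folded x_def]
  have v0: "v 0 = real a" "v (Suc 0) = real b" "v 2 = fact m" "v 3 = real h" "v 4 = real q"
      "v 5 = eval_fps (tail_fps j) z" "v 6 = z ^ j / fact j" "v 7 = u" "v 8 = real j"
    using v by (simp_all add: level_vars_def h_def k_def q_def z_def)
  have q: "q = fact m * (3 * B) ^ n + 1" by (simp add: q_def modulus_def B_def k_def)
  have "0 < q" by (simp add: q)
  then have z: "0 < z" by (simp add: z_def)
  have B1: "1 \<le> B" "2 \<le> B" by (simp_all add: B_def)
  have Bh: "4 * real h = real B" by (simp add: B_def h_def power_add)
  have W: "real (W y) = fact m * level_weight j a b y" for y
    unfolding W_def by (rule real_integer_weight[OF b])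
  have t_less: "t < h" unfolding t_def W_def h_def k_def by (rule sum_integer_weight_less[OF a(2) b])
  have "real t = fact m * configurations j a b" unfolding t_def W_def by (rule sum_integer_weight[OF b])
  then have t0: "0 < t" using c by (metis fact_gt_zero of_nat_0_less_iff mult_pos_pos)
  have S_less: "(\<Sum>i\<le>y. W i) < B" if "y \<le> a" for y
  proof -
    have "(\<Sum>i\<le>y. W i) \<le> t" unfolding t_def using that by (intro sum_mono2) auto
    also have "t < B" using t_less by (simp add: B_def h_def)
    finally show ?thesis .
  qed
  have W_less: "W y < B" if "y \<le> a" for y
    using S_less[OF that] member_le_sum[of y "{..y}" W] by simp
  \<comment> \<open>The two readings of the marked series: \<beta> = 1 yields the total, \<beta> = B
    the packed weights.\<close>
  have tot: "series_digit (fact m * eval_fps (tail_fps j) z ^ a) (real q) (real b) = real t"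
    using level_digit[OF a(2) b order.refl B1(1) q, of j] by (simp add: marked_fps_1 z_def t_def W_def)
  have dig: "series_digit (fact m * (real B * (z ^ j / fact j) + eval_fps (tail_fps (Suc j)) z) ^ a) (real q) (real b) = real G"
    using level_digit[OF a(2) b B1(1) order.refl q, of j] by (simp add: eval_marked z_def G_def W_def)
  have pre: "prefix_number (real B) (real t) (real G) (real a) = real P"
    unfolding t_def G_def P_def by (rule prefix_number_sum[OF B1(2)])
  have scale: "(\<lambda>y. real (W y)) = (\<lambda>y. fact m * level_weight j a b y)" using W by (simp add: fun_eq_iff)
  have sel: "rselect (real h) (real B) (real t) (real P) (real a) u = real x"
    unfolding P_def x_def rselect_eq[OF h_def B_def t_def t0 t_less u] scale by (simp add: selected_scale)
  have dP: "base_digit (real B) (real P) (real x) = real (\<Sum>i\<le>x. W i)"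
    unfolding P_def by (rule base_digit_sum[OF S_less step(3)])
  have dG: "base_digit (real B) (real G) (real x) = real (W x)"
    unfolding G_def by (rule base_digit_sum[OF W_less step(3)])
  have "selected (\<lambda>y. real (W y)) a u = x" unfolding scale x_def by (simp add: selected_scale)
  moreover have "rescaled (level_weight j a b) a u = rescaled (\<lambda>y. real (W y)) a u"
    unfolding scale by (simp add: rescaled_scale)
  moreover have "real (\<Sum>i\<le>x. W i) - real (W x) = (\<Sum>i<x. real (W i))" by (simp flip: lessThan_Suc_atMost)
  ultimately have resc: "(u * real t - (base_digit (real B) (real P) (real x) - base_digit (real B) (real G) (real x)))
       / base_digit (real B) (real G) (real x) = rescaled (level_weight j a b) a u"
    unfolding dP dG by (simp add: rescaled_def Let_def t_def)
  have pow1: "eval_fps (tail_fps j) z powr real a = eval_fps (tail_fps j) z ^ a"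
    using z by (intro powr_realpow eval_tail_pos)
  have "0 < real B * (z ^ j / fact j) + eval_fps (tail_fps (Suc j)) z"
    using z B1 by (intro add_pos_pos eval_tail_pos) auto
  then have pow2: "(real B * (z ^ j / fact j) + eval_fps (tail_fps (Suc j)) z) powr real a
     = (real B * (z ^ j / fact j) + eval_fps (tail_fps (Suc j)) z) ^ a"
    by (rule powr_realpow)
  \<comment> \<open>From j \<le> b \<le> m: the next output address j + 1 stays below the variables,
    which start at m + 2.\<close>
  have jm: "Suc (length ws) < m + 2" using step(2) b ws by simp
  define v1 where "v1 = v(9 := real t)"
  define v2 where "v2 = v1(5 := eval_fps (tail_fps (Suc j)) z)"
  define v3 where "v3 = v2(10 := real G)"
  define v4 where "v4 = v3(11 := real P)"
  define v5 where "v5 = v4(12 := real x)"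
  define v6 where "v6 = v5(7 := rescaled (level_weight j a b) a u)"
  define v7 where "v7 = v6(0 := real (a - x))"
  define v8 where "v8 = v7(1 := real (b - j * x))"
  define v9 where "v9 = v8(8 := real (Suc j))"
  define v10 where "v10 = v9(6 := z ^ Suc j / fact (Suc j))"
  note vs = v10_def v9_def v8_def v7_def v6_def v5_def v4_def v3_def v2_def v1_def
  have "transforms (frame (m + 2) ws v) level_cmd (frame (m + 2) (ws @ [real x]) v10)"
    unfolding level_cmd_def
  proof (intro transforms_Seq)
    show "transforms (frame (m + 2) ws v) (Store (var_address 9)
       (series_digit_expr (Binary Mul (var 2) (Binary Pow (var 5) (var 0))) (var 4) (var 1))) (frame (m + 2) ws v1)"
      unfolding v1_def by (rule transforms_assign) (simp add: var_val v0 pow1 tot del: expr_val.simps(2))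
    show "transforms (frame (m + 2) ws v1) (Store (var_address 5) (Binary Sub (var 5) (var 6))) (frame (m + 2) ws v2)"
      unfolding v2_def by (rule transforms_assign)
        (simp add: var_val v0 v1_def eval_tail_Suc del: expr_val.simps(2))
    show "transforms (frame (m + 2) ws v2) (Store (var_address 10) (series_digit_expr (Binary Mul (var 2) (Binary Pow
       (Binary Add (Binary Mul (Binary Mul (Const 4) (var 3)) (var 6)) (var 5)) (var 0))) (var 4) (var 1)))
       (frame (m + 2) ws v3)"
      unfolding v3_def by (rule transforms_assign)
        (simp add: var_val v0 v2_def v1_def Bh pow2 dig del: expr_val.simps(2) times_divide_eq_right)
    show "transforms (frame (m + 2) ws v3) (Store (var_address 11)
       (prefix_expr (Binary Mul (Const 4) (var 3)) (var 9) (var 10) (var 0))) (frame (m + 2) ws v4)"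
      unfolding v4_def by (rule transforms_assign)
        (simp add: var_val v0 v3_def v2_def v1_def Bh pre del: expr_val.simps(2))
    show "transforms (frame (m + 2) ws v4) (Store (var_address 12)
       (select_expr (var 3) (Binary Mul (Const 4) (var 3)) (var 9) (var 11) (var 0) (var 7))) (frame (m + 2) ws v5)"
      unfolding v5_def by (rule transforms_assign)
        (simp add: var_val v0 v4_def v3_def v2_def v1_def Bh sel del: expr_val.simps(2))
    show "transforms (frame (m + 2) ws v5) (Store (Binary Add (var 8) (Const 1)) (var 12))
       (frame (m + 2) (ws @ [real x]) v5)"
      using jm by (intro transforms_output)
        (simp_all add: var_val v0 v5_def v4_def v3_def v2_def v1_def ws del: expr_val.simps(2))
    show "transforms (frame (m + 2) (ws @ [real x]) v5)
       (Store (var_address 7) (let w = base_digit_expr (Binary Mul (Const 4) (var 3)) (var 10) (var 12)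
       in Binary Div (Binary Sub (Binary Mul (var 7) (var 9))
         (Binary Sub (base_digit_expr (Binary Mul (Const 4) (var 3)) (var 11) (var 12)) w)) w))
       (frame (m + 2) (ws @ [real x]) v6)"
      unfolding v6_def by (rule transforms_assign)
        (simp add: var_val v0 v5_def v4_def v3_def v2_def v1_def Bh Let_def resc del: expr_val.simps(2))
    show "transforms (frame (m + 2) (ws @ [real x]) v6) (Store (var_address 0) (Binary Sub (var 0) (var 12)))
       (frame (m + 2) (ws @ [real x]) v7)"
      unfolding v7_def by (rule transforms_assign)
        (simp add: var_val v0 v6_def v5_def v4_def v3_def v2_def v1_def of_nat_diff[OF step(3)] del: expr_val.simps(2))
    show "transforms (frame (m + 2) (ws @ [real x]) v7)
       (Store (var_address 1) (Binary Sub (var 1) (Binary Mul (var 8) (var 12))))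
       (frame (m + 2) (ws @ [real x]) v8)"
      unfolding v8_def by (rule transforms_assign)
        (simp add: var_val v0 v7_def v6_def v5_def v4_def v3_def v2_def v1_def of_nat_diff[OF step(4)] del: expr_val.simps(2))
    show "transforms (frame (m + 2) (ws @ [real x]) v8) (Store (var_address 8) (Binary Add (var 8) (Const 1)))
       (frame (m + 2) (ws @ [real x]) v9)"
      unfolding v9_def by (rule transforms_assign)
        (simp add: var_val v0 v8_def v7_def v6_def v5_def v4_def v3_def v2_def v1_def del: expr_val.simps(2))
    show "transforms (frame (m + 2) (ws @ [real x]) v9)
       (Store (var_address 6) (Binary Div (Binary Div (var 6) (var 4)) (var 8)))
       (frame (m + 2) (ws @ [real x]) v10)"
      unfolding v10_def by (rule transforms_assign)
        (simp add: var_val v0 v9_def v8_def v7_def v6_def v5_def v4_def v3_def v2_def v1_def z_def field_simps del: expr_val.simps(2))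
  qed
  moreover have "level_vars n m (Suc j) (a - x) (b - j * x) (rescaled (level_weight j a b) a u) v10"
    by (simp add: level_vars_def vs v0 h_def k_def q_def[symmetric] z_def[symmetric])
  ultimately show ?thesis by blast
qed

lemma loop_exec:
  assumes "frame (m + 2) ws v M" and "level_vars n m j a b u v" and "length ws = j"
    and "a \<le> n" and "b \<le> m" and "0 < configurations j a b" and "0 \<le> u" and "u < 1"
  shows "\<exists>M' v'. exec (While level_test level_cmd) (M, \<omega>)
      (test_cost level_test + length (bins_from j a b u) * (test_cost level_test + straight_cost level_cmd)) (M', \<omega>) \<and>
    frame (m + 2) (ws @ map real (bins_from j a b u)) v' M' \<and> v' 8 = real (j + length (bins_from j a b u))"
  using assms
proof (induction "Suc b - j" arbitrary: j a b u ws v M rule: less_induct)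
  case less
  have test: "test_val level_test M \<longleftrightarrow> 0 < a"
    using var_val[OF less.prems(1), of 0] less.prems(2)
    by (simp add: level_test_def level_vars_def del: expr_val.simps(2))
  show ?case
  proof (cases "0 < a")
    case False
    then have "bins_from j a b u = []" by (simp add: bins_from.simps)
    moreover have "exec (While level_test level_cmd) (M, \<omega>) (test_cost level_test) (M, \<omega>)"
      using test False by (intro exec.WhileFalse) simp
    ultimately show ?thesis
      using less.prems by (intro exI[of _ M] exI[of _ v]) (simp add: level_vars_def)
  next
    case True
    define x where "x = selected (level_weight j a b) a u"
    define u' where "u' = rescaled (level_weight j a b) a u"
    note step = bins_from_step[OF True less.prems(6-8), folded x_def u'_def]
    obtain v1 where v1: "level_vars n m (Suc j) (a - x) (b - j * x) u' v1"
      and tr: "transforms (frame (m + 2) ws v) level_cmd (frame (m + 2) (ws @ [real x]) v1)"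
      using level_cmd_transforms[OF True less.prems(4-8,3,2)] unfolding x_def u'_def by blast
    obtain M1 where M1: "exec level_cmd (M, \<omega>) (straight_cost level_cmd) (M1, \<omega>)"
        "frame (m + 2) (ws @ [real x]) v1 M1"
      using tr less.prems(1) unfolding transforms_def by blast
    have "Suc (b - j * x) - Suc j < Suc b - j" using step(2) by simp
    moreover have "length (ws @ [real x]) = Suc j" "a - x \<le> n" "b - j * x \<le> m"
      using less.prems by auto
    ultimately obtain M' v' where M': "exec (While level_test level_cmd) (M1, \<omega>) (test_cost level_test +
        length (bins_from (Suc j) (a - x) (b - j * x) u') * (test_cost level_test + straight_cost level_cmd)) (M', \<omega>)"
      "frame (m + 2) ((ws @ [real x]) @ map real (bins_from (Suc j) (a - x) (b - j * x) u')) v' M'"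
      "v' 8 = real (Suc j + length (bins_from (Suc j) (a - x) (b - j * x) u'))"
      using less.hyps[OF _ M1(2) v1 _ _ _ step(6-8)] by blast
    from exec.WhileTrue[OF _ M1(1) M'(1)] test True
    have "exec (While level_test level_cmd) (M, \<omega>) (test_cost level_test + straight_cost level_cmd +
      (test_cost level_test + length (bins_from (Suc j) (a - x) (b - j * x) u') * (test_cost level_test + straight_cost level_cmd))) (M', \<omega>)"
      by simp
    then show ?thesis using M'(2,3)
      by (intro exI[of _ M'] exI[of _ v']) (simp add: step(1) algebra_simps)
  qed
qed

text \<open>The inputs are saved as variables 0 and 1 before register 0 becomes the base pointer;
  register 1 will later be overwritten by the first output entry. The final level number is the
  length of the output.\<close>

definition cardinalities_cmd :: cmd where
  "cardinalities_cmd = Seq (Store (Binary Add (Load (Const 1)) (Const 2)) (Load (Const 0)))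
    (Seq (Store (Binary Add (Load (Const 1)) (Const 3)) (Load (Const 1)))
    (Seq (Store (Const 0) (Binary Add (Load (Const 1)) (Const 2)))
    (Seq (Sample (var_address 7))
    (Seq init_cmd
    (Seq (While level_test level_cmd)
    (Store (Const 0) (var 8)))))))"

definition fixed_cost :: nat where
  "fixed_cost = straight_cost (Store (Binary Add (Load (Const 1)) (Const 2)) (Load (Const 0))) +
     straight_cost (Store (Binary Add (Load (Const 1)) (Const 3)) (Load (Const 1))) +
     straight_cost (Store (Const 0) (Binary Add (Load (Const 1)) (Const 2))) +
     straight_cost (Sample (var_address 7)) + straight_cost init_cmd + test_cost level_test +
     straight_cost (Store (Const 0) (var 8))"

definition level_cost :: nat where
  "level_cost = test_cost level_test + straight_cost level_cmd"

text \<open>Taking the fractional part of the sample guarantees 0 \<le> u < 1 for every random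
  stream, so the program is correct pointwise and not merely almost surely.\<close>

lemma init_cmd_transforms:
  assumes m: "1 \<le> m" and v: "v 0 = real n" "v 1 = real m"
  shows "\<exists>v'. level_vars n m 0 n m (frac (v 7)) v' \<and>
    transforms (frame base ws v) init_cmd (frame base ws v')"
proof -
  define h :: nat where "h = 2 ^ (fact m + 2 * n)"
  define v2 where "v2 = v(2 := fact m)"
  define v3 where "v3 = v2(3 := real h)"
  define v4 where "v4 = v3(4 := real (modulus n m))"
  define v5 where "v5 = v4(5 := exp (1 / modulus n m))"
  define v6 where "v6 = v5(6 := 1)"
  define v7 where "v7 = v6(7 := frac (v 7))"
  define v8 where "v8 = v7(8 := 0)"
  note vs = v8_def v7_def v6_def v5_def v4_def v3_def v2_def
  have h: "2 powr (fact m + 2 * real n) = real h"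
    using powr_realpow[of 2 "fact m + 2 * n"] by (simp add: h_def)
  have h12: "(12 * real h) powr real n = (12 * real h) ^ n"
    by (rule powr_realpow) (simp add: h_def)
  have q: "fact m * (12 * real h) ^ n + 1 = real (modulus n m)"
    by (simp add: modulus_def h_def power_add)
  have "transforms (frame base ws v) init_cmd (frame base ws v8)"
    unfolding init_cmd_def
  proof (intro transforms_Seq)
    show "transforms (frame base ws v) (Store (var_address 2) (fact_expr (var 1))) (frame base ws v2)"
      unfolding v2_def using rfact_of_nat[OF m] v
      by (intro transforms_assign) (simp add: var_val del: expr_val.simps(2))
    show "transforms (frame base ws v2) (Store (var_address 3)
        (Binary Pow (Const 2) (Binary Add (var 2) (Binary Mul (Const 2) (var 0))))) (frame base ws v3)"
      unfolding v3_def by (rule transforms_assign) (simp add: var_val v2_def v h del: expr_val.simps(2))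
    show "transforms (frame base ws v3) (Store (var_address 4) (Binary Add (Binary Mul (var 2)
       (Binary Pow (Binary Mul (Const 12) (var 3)) (var 0))) (Const 1))) (frame base ws v4)"
      unfolding v4_def by (rule transforms_assign)
        (simp add: var_val v3_def v2_def v h12 q[unfolded power_mult_distrib] power_mult_distrib del: expr_val.simps(2))
    show "transforms (frame base ws v4) (Store (var_address 5) (Unary Exp (Binary Div (Const 1) (var 4))))
        (frame base ws v5)"
      unfolding v5_def by (rule transforms_assign) (simp add: var_val v4_def del: expr_val.simps(2))
    show "transforms (frame base ws v5) (Store (var_address 6) (Const 1)) (frame base ws v6)"
      unfolding v6_def by (rule transforms_assign) simp
    show "transforms (frame base ws v6) (Store (var_address 7) (Binary Sub (var 7) (Unary Floor (var 7))))
        (frame base ws v7)"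
      unfolding v7_def by (rule transforms_assign)
        (simp add: var_val v6_def v5_def v4_def v3_def v2_def frac_def del: expr_val.simps(2))
    show "transforms (frame base ws v7) (Store (var_address 8) (Const 0)) (frame base ws v8)"
      unfolding v8_def by (rule transforms_assign) simp
  qed
  moreover have "level_vars n m 0 n m (frac (v 7)) v8"
    using v by (simp add: level_vars_def vs eval_tail_0 h_def)
  ultimately show ?thesis by blast
qed

lemma cardinalities_cmd_exec:
  fixes \<omega> :: "real stream"
  assumes n: "1 \<le> n" and m: "1 \<le> m"
  defines "xs \<equiv> bins_from 0 n m (frac (shd \<omega>))"
  shows "\<exists>M. exec cardinalities_cmd (initial_memory n m, \<omega>) (fixed_cost + level_cost * length xs) (M, stl \<omega>) \<and>
    M 0 = real (length xs) \<and> (\<forall>i<length xs. M (Suc i) = real (xs ! i))"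
proof -
  define M1 where "M1 = (initial_memory n m)(m + 2 := real n)"
  define M2 where "M2 = M1(m + 3 := real m)"
  define M3 where "M3 = M2(0 := real (m + 2))"
  define M4 where "M4 = M3(m + 2 + 7 := shd \<omega>)"
  have ad [simp]: "address 0 = 0" "address 1 = 1" "address (real m + 2) = m + 2" "address (real m + 3) = m + 3"
    using address_of_nat[of 0] address_of_nat[of 1] address_of_nat[of "m + 2"] address_of_nat[of "m + 3"]
    by (simp_all del: address_of_nat add: add.commute)
  have 1: "exec (Store (Binary Add (Load (Const 1)) (Const 2)) (Load (Const 0))) (initial_memory n m, \<omega>)
      (straight_cost (Store (Binary Add (Load (Const 1)) (Const 2)) (Load (Const 0)))) (M1, \<omega>)"
    using exec.Store[of "Binary Add (Load (Const 1)) (Const 2)" "Load (Const 0)" "initial_memory n m" \<omega>]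
    by (simp add: M1_def initial_memory_def)
  have 2: "exec (Store (Binary Add (Load (Const 1)) (Const 3)) (Load (Const 1))) (M1, \<omega>)
      (straight_cost (Store (Binary Add (Load (Const 1)) (Const 3)) (Load (Const 1)))) (M2, \<omega>)"
    using exec.Store[of "Binary Add (Load (Const 1)) (Const 3)" "Load (Const 1)" M1 \<omega>]
    by (simp add: M2_def M1_def initial_memory_def)
  have 3: "exec (Store (Const 0) (Binary Add (Load (Const 1)) (Const 2))) (M2, \<omega>)
      (straight_cost (Store (Const 0) (Binary Add (Load (Const 1)) (Const 2)))) (M3, \<omega>)"
    using exec.Store[of "Const 0" "Binary Add (Load (Const 1)) (Const 2)" M2 \<omega>]
    by (simp add: M3_def M2_def M1_def initial_memory_def add.commute)
  have fr3: "frame (m + 2) [] (\<lambda>i. M3 (m + 2 + i)) M3"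
    by (simp add: frame_def M3_def)
  have 4: "exec (Sample (var_address 7)) (M3, \<omega>) (straight_cost (Sample (var_address 7))) (M4, stl \<omega>)"
    using exec.Sample[of "var_address 7" M3 \<omega>] by (simp add: var_address_val[OF fr3] M4_def)
  define v4 where "v4 = (\<lambda>i. M4 (m + 2 + i))"
  have fr4: "frame (m + 2) [] v4 M4"
    by (simp add: frame_def M4_def M3_def v4_def)
  have "v4 0 = real n" "v4 1 = real m" "v4 7 = shd \<omega>"
    by (simp_all add: v4_def M4_def M3_def M2_def M1_def initial_memory_def)
  from init_cmd_transforms[OF m this(1,2), of "m + 2" "[]", unfolded this(3)]
  obtain v5 where v5: "level_vars n m 0 n m (frac (shd \<omega>)) v5"
    and tr: "transforms (frame (m + 2) [] v4) init_cmd (frame (m + 2) [] v5)" by blast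
  obtain M5 where 5: "exec init_cmd (M4, stl \<omega>) (straight_cost init_cmd) (M5, stl \<omega>)"
    and fr5: "frame (m + 2) [] v5 M5"
    using tr fr4 unfolding transforms_def by blast
  have "0 < configurations 0 n m" using n by (simp add: configurations_from_0)
  from loop_exec[OF fr5 v5 _ order.refl order.refl this frac_ge_0 frac_lt_1, of "stl \<omega>", folded xs_def]
  obtain M6 v6 where 6: "exec (While level_test level_cmd) (M5, stl \<omega>)
      (test_cost level_test + length xs * level_cost) (M6, stl \<omega>)"
    and fr6: "frame (m + 2) (map real xs) v6 M6" and v6: "v6 8 = real (length xs)"
    by (auto simp: level_cost_def)
  define M7 where "M7 = M6(0 := real (length xs))"
  have "expr_val (var 8) M6 = real (length xs)" using var_val[OF fr6] v6 by metis
  then have 7: "exec (Store (Const 0) (var 8)) (M6, stl \<omega>) (straight_cost (Store (Const 0) (var 8))) (M7, stl \<omega>)"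
    using exec.Store[of "Const 0" "var 8" M6 "stl \<omega>"] by (simp add: M7_def del: expr_val.simps(2))
  have "exec cardinalities_cmd (initial_memory n m, \<omega>) (fixed_cost + level_cost * length xs) (M7, stl \<omega>)"
    using exec.Seq[OF 1 exec.Seq[OF 2 exec.Seq[OF 3 exec.Seq[OF 4 exec.Seq[OF 5 exec.Seq[OF 6 7]]]]]]
    by (simp only: cardinalities_cmd_def fixed_cost_def ac_simps)
  moreover have "M7 0 = real (length xs) \<and> (\<forall>i<length xs. M7 (Suc i) = real (xs ! i))"
    using fr6 by (simp add: M7_def frame_def)
  ultimately show ?thesis by blast
qed

section \<open>Counting allocations\<close>

text \<open>Serves twice: for bin cardinalities it is the multiset of loads, and for loads it is the
  multiset of bins hit by the balls. Both counts below are multinomial coefficients of such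
  multisets.\<close>

definition value_mset :: "nat list \<Rightarrow> nat multiset" where
  "value_mset xs = (\<Sum>j<length xs. replicate_mset (xs ! j) j)"

lemma count_value_mset: "count (value_mset xs) j = (if j < length xs then xs ! j else 0)"
  by (simp add: value_mset_def count_sum)

lemma size_value_mset: "size (value_mset xs) = sum_list xs"
proof -
  have "size (\<Sum>j\<in>S. replicate_mset (xs ! j) j) = (\<Sum>j\<in>S. xs ! j)" if "finite S" for S
    using that by induction auto
  then show ?thesis by (simp add: value_mset_def sum_list_sum_nth atLeast0LessThan)
qed

lemma sum_value_mset: "sum_mset (value_mset xs) = (\<Sum>j<length xs. j * xs ! j)"
proof -
  have "sum_mset (\<Sum>j\<in>S. replicate_mset (xs ! j) j) = (\<Sum>j\<in>S. j * xs ! j)" if "finite S" for S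
    using that by induction auto
  then show ?thesis by (simp add: value_mset_def)
qed

lemma prod_value_mset:
  "(\<Prod>v\<in>#value_mset xs. fact v :: nat) = (\<Prod>j<length xs. fact j ^ (xs ! j))"
proof -
  have "(\<Prod>v\<in>#(\<Sum>j\<in>S. replicate_mset (xs ! j) j). fact v :: nat) = (\<Prod>j\<in>S. fact j ^ (xs ! j))" if "finite S" for S
    using that by induction auto
  then show ?thesis by (simp add: value_mset_def)
qed

lemma card_permutations_value_mset:
  "card (permutations_of_multiset (value_mset xs)) * (\<Prod>j<length xs. fact (xs ! j)) = fact (sum_list xs)"
proof -
  have "(\<Prod>j<length xs. fact (xs ! j) :: nat) = (\<Prod>j<length xs. fact (count (value_mset xs) j))"
    by (intro prod.cong) (auto simp: count_value_mset)
  also have "\<dots> = (\<Prod>j\<in>set_mset (value_mset xs). fact (count (value_mset xs) j))"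
    by (intro prod.mono_neutral_right)
      (auto simp: count_value_mset not_in_iff simp flip: count_greater_zero_iff split: if_splits)
  finally show ?thesis
    using card_permutations_of_multiset_aux[of "value_mset xs"] by (simp add: size_value_mset)
qed

text \<open>The binomial coefficients telescope to a multinomial one: each \<open>a choose x\<close>
  contributes a denominator \<open>fact x\<close> and hands \<open>fact (a - x)\<close> to the next
  level.\<close>

lemma outcome_weight_eq:
  "outcome_weight j a b xs = (if sum_list xs = a \<and> (\<Sum>i<length xs. (j + i) * xs ! i) = b \<and> (xs = [] \<or> last xs \<noteq> 0)
     then fact a / (\<Prod>i<length xs. fact (xs ! i) * fact (j + i) ^ (xs ! i)) else 0)"
proof (induction xs arbitrary: j a b)
  case (Cons x xs)
  have s: "(\<Sum>i<length (x # xs). (j + i) * (x # xs) ! i) = j * x + (\<Sum>i<length xs. (Suc j + i) * xs ! i)"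
    by (simp add: sum.lessThan_Suc_shift del: sum.lessThan_Suc)
  have p: "(\<Prod>i<length (x # xs). fact ((x # xs) ! i) * fact (j + i) ^ ((x # xs) ! i) :: real) =
      fact x * fact j ^ x * (\<Prod>i<length xs. fact (xs ! i) * fact (Suc j + i) ^ (xs ! i))"
    by (simp add: prod.lessThan_Suc_shift del: prod.lessThan_Suc)
  show ?case
  proof (cases "0 < a \<and> x \<le> a \<and> j * x \<le> b")
    case True
    define R where "R = (\<Sum>i<length xs. (Suc j + i) * xs ! i)"
    define d where "d = (\<Prod>i<length xs. fact (xs ! i) * fact (Suc j + i) ^ (xs ! i) :: real)"
    have ow: "outcome_weight j a b (x # xs) = real (a choose x) / fact j ^ x *
        (if sum_list xs = a - x \<and> R = b - j * x \<and> (xs = [] \<or> last xs \<noteq> 0) then fact (a - x) / d else 0)"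
      using True by (simp only: outcome_weight.simps Cons R_def d_def if_True simp_thms)
    have "(sum_list xs = a - x \<and> R = b - j * x \<and> (xs = [] \<or> last xs \<noteq> 0)) \<longleftrightarrow>
        (sum_list (x # xs) = a \<and> j * x + R = b \<and> (x # xs = [] \<or> last (x # xs) \<noteq> 0))"
      using True by (cases xs) auto
    moreover have "real (a choose x) / fact j ^ x * (fact (a - x) / d) = fact a / (fact x * fact j ^ x * d)"
      using True by (simp add: binomial_fact)
    ultimately show ?thesis
      unfolding ow s p R_def[symmetric] d_def[symmetric] by (simp only: mult_zero_right split: if_split) blast
  next
    case False
    have "\<not> (sum_list (x # xs) = a \<and> (\<Sum>i<length (x # xs). (j + i) * (x # xs) ! i) = b \<and> last (x # xs) \<noteq> 0)"
    proof (intro notI, elim conjE)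
      assume sum: "sum_list (x # xs) = a" and last: "last (x # xs) \<noteq> 0"
        and "(\<Sum>i<length (x # xs). (j + i) * (x # xs) ! i) = b"
      then have "j * x \<le> b" unfolding s by linarith
      moreover have "last (x # xs) \<le> a"
        using member_le_sum_list[of "last (x # xs)" "x # xs"] sum last_in_set[of "x # xs"]
        by (simp only: list.distinct not_False_eq_True zero_le simp_thms)
      moreover have "x \<le> a" using sum by simp
      ultimately show False using False last by linarith
    qed
    moreover have "outcome_weight j a b (x # xs) = 0" using False by (simp only: outcome_weight.simps if_False)
    ultimately show ?thesis by (simp only: list.distinct if_False simp_thms)
  qed
qed simp

section \<open>Allocations with given loads and with given bin cardinalities\<close>

definition allocations :: "nat \<Rightarrow> nat \<Rightarrow> (nat \<Rightarrow> nat) set" where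
  "allocations n m = PiE_dflt {..<m} 0 (\<lambda>_. {..<n})"

definition loads :: "nat \<Rightarrow> nat \<Rightarrow> (nat \<Rightarrow> nat) \<Rightarrow> nat list" where
  "loads n m f = map (occupancy m f) [0..<n]"

lemma finite_allocations [simp]: "finite (allocations n m)"
  by (simp add: allocations_def finite_PiE_dflt)

lemma card_allocations: "card (allocations n m) = n ^ m"
  by (simp add: allocations_def card_PiE_dflt)

lemma allocation_pmf_eq: "1 \<le> n \<Longrightarrow> allocation_pmf n m = pmf_of_set (allocations n m)"
  unfolding allocation_pmf_def allocations_def by (rule Pi_pmf_of_set) (auto simp: lessThan_empty_iff)

lemma count_mset_map: "count (mset (map f [0..<m])) i = occupancy m f i"
proof -
  have "count (mset (map f [0..<m])) i = length (filter (\<lambda>b. i = f b) [0..<m])"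
    unfolding count_mset by (induction m) (auto simp: count_list_append)
  also have "\<dots> = card (set (filter (\<lambda>b. i = f b) [0..<m]))"
    by (subst distinct_card) auto
  also have "set (filter (\<lambda>b. i = f b) [0..<m]) = {b. b < m \<and> f b = i}" by auto
  finally show ?thesis by (simp add: occupancy_def)
qed

lemma occupancy_eq_0: "f \<in> allocations n m \<Longrightarrow> n \<le> i \<Longrightarrow> occupancy m f i = 0"
proof -
  assume f: "f \<in> allocations n m" and i: "n \<le> i"
  have "f b < n" if "b < m" for b using f that by (auto simp: allocations_def PiE_dflt_def)
  then have "{b. b < m \<and> f b = i} = {}" using i by (auto simp: not_less dest: leD)
  then show ?thesis by (simp only: occupancy_def card.empty)
qed

lemma mset_map_eq_value_mset:
  assumes "f \<in> allocations n m" "length N = n"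
  shows "mset (map f [0..<m]) = value_mset N \<longleftrightarrow> loads n m f = N"
proof -
  have "mset (map f [0..<m]) = value_mset N \<longleftrightarrow> (\<forall>i. occupancy m f i = (if i < n then N ! i else 0))"
    by (simp only: multiset_eq_iff count_mset_map count_value_mset assms(2))
  also have "\<dots> \<longleftrightarrow> (\<forall>i<n. occupancy m f i = N ! i)"
    using occupancy_eq_0[OF assms(1)] by (auto simp: not_less)
  also have "\<dots> \<longleftrightarrow> loads n m f = N"
    using assms(2) by (auto simp: loads_def list_eq_iff_nth_eq)
  finally show ?thesis .
qed

lemma sum_loads: "f \<in> allocations n m \<Longrightarrow> sum_list (loads n m f) = m"
  using mset_map_eq_value_mset[of f n m "loads n m f"] size_value_mset[of "loads n m f"]
  by (metis diff_zero length_map length_upt loads_def size_mset)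

text \<open>Listing the bins of balls 0, ..., m - 1 identifies these allocations with the
  arrangements of the multiset in which bin i occurs \<open>N ! i\<close> times.\<close>

lemma card_allocations_with_loads:
  assumes N: "length N = n" "sum_list N = m"
  shows "card {f \<in> allocations n m. loads n m f = N} * (\<Prod>i<n. fact (N ! i)) = fact m"
proof -
  have "bij_betw (\<lambda>f. map f [0..<m]) {f \<in> allocations n m. loads n m f = N} (permutations_of_multiset (value_mset N))"
  proof (rule bij_betwI[where g = "\<lambda>ys b. if b < m then ys ! b else 0"])
    show "(\<lambda>f. map f [0..<m]) \<in> {f \<in> allocations n m. loads n m f = N} \<rightarrow> permutations_of_multiset (value_mset N)"
      using mset_map_eq_value_mset[OF _ N(1)] by (auto simp: permutations_of_multiset_def)
    show "(\<lambda>ys b. if b < m then ys ! b else 0) \<in> permutations_of_multiset (value_mset N) \<rightarrow> {f \<in> allocations n m. loads n m f = N}"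
    proof
      fix ys assume "ys \<in> permutations_of_multiset (value_mset N)"
      then have ys: "mset ys = value_mset N" by (simp add: permutations_of_multiset_def)
      let ?f = "\<lambda>b. if b < m then ys ! b else 0"
      have len: "length ys = m" using ys N by (metis size_mset size_value_mset)
      have map: "map ?f [0..<m] = ys" using len by (intro nth_equalityI) auto
      have "ys ! b < n" if "b < m" for b
      proof -
        have "ys ! b \<in># value_mset N" using that len unfolding ys[symmetric] by simp
        then show ?thesis using N by (auto simp: count_value_mset simp flip: count_greater_zero_iff split: if_splits)
      qed
      then have "?f \<in> allocations n m" by (auto simp: allocations_def PiE_dflt_def)
      then show "?f \<in> {f \<in> allocations n m. loads n m f = N}"
        using mset_map_eq_value_mset[of ?f n m N] map ys N by simp
    qed
    show "(\<lambda>b. if b < m then map f [0..<m] ! b else 0) = f" if "f \<in> {f \<in> allocations n m. loads n m f = N}" for f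
      using that by (auto simp: allocations_def PiE_dflt_def fun_eq_iff)
    show "map (\<lambda>b. if b < m then ys ! b else 0) [0..<m] = ys" if "ys \<in> permutations_of_multiset (value_mset N)" for ys
      using that N by (intro nth_equalityI) (auto simp: permutations_of_multiset_def size_value_mset simp flip: size_mset)
  qed
  then have "card {f \<in> allocations n m. loads n m f = N} = card (permutations_of_multiset (value_mset N))"
    by (rule bij_betw_same_card)
  then show ?thesis using card_permutations_value_mset[of N] N by simp
qed

lemma bin_cardinality_eq_count: "bin_cardinality n m f j = count (mset (loads n m f)) j"
proof -
  have "count (mset (loads n m f)) j = occupancy n (occupancy m f) j"
    unfolding loads_def by (rule count_mset_map)
  then show ?thesis by (simp add: occupancy_def bin_cardinality_def)
qed

text \<open>The multiset of loads determines xs up to trailing zeros, and a nonzero last entry says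
  that the vector stops exactly at the maximum load.\<close>

lemma bin_cardinalities_eq_iff:
  assumes "1 \<le> n"
  shows "bin_cardinalities n m f = xs \<longleftrightarrow> mset (loads n m f) = value_mset xs \<and> xs \<noteq> [] \<and> last xs \<noteq> 0"
proof -
  let ?A = "mset (loads n m f)"
  have set: "set_mset ?A = occupancy m f ` {..<n}" by (auto simp: loads_def)
  have fin: "finite (set_mset ?A)" and ne: "set_mset ?A \<noteq> {}"
    unfolding set using assms by (auto simp: lessThan_empty_iff)
  define K where "K = max_occupancy n m f"
  have K: "K = Max (set_mset ?A)" by (simp only: K_def max_occupancy_def set)
  have Kin: "K \<in># ?A" and Kle: "\<And>v. v \<in># ?A \<Longrightarrow> v \<le> K"
    unfolding K using Max_in[OF fin ne] Max_ge[OF fin] by auto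
  have bc: "bin_cardinalities n m f = map (count ?A) [0..<Suc K]"
    by (simp add: bin_cardinalities_def K_def bin_cardinality_eq_count)
  show ?thesis
  proof
    assume "bin_cardinalities n m f = xs"
    then have xs: "xs = map (count ?A) [0..<Suc K]" by (simp add: bc)
    have "?A = value_mset xs"
    proof (rule multiset_eqI)
      fix j
      have "count ?A j = 0" if "K < j" using that Kle[of j] by (metis leD not_in_iff)
      then show "count ?A j = count (value_mset xs) j"
        by (auto simp: count_value_mset xs simp del: upt_Suc)
    qed
    moreover have "last xs = count ?A K" by (simp add: xs)
    ultimately show "?A = value_mset xs \<and> xs \<noteq> [] \<and> last xs \<noteq> 0" using Kin by (simp add: xs)
  next
    assume *: "?A = value_mset xs \<and> xs \<noteq> [] \<and> last xs \<noteq> 0"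
    then have A: "count ?A j = (if j < length xs then xs ! j else 0)" for j by (simp add: count_value_mset)
    have "count ?A (length xs - 1) = last xs" using * A[of "length xs - 1"] by (simp add: last_conv_nth)
    then have "length xs - 1 \<in># ?A" using * by (simp flip: count_greater_zero_iff)
    then have "length xs \<le> Suc K" using Kle[of "length xs - 1"] by simp
    moreover have "K < length xs" using Kin A[of K] by (simp split: if_splits flip: count_greater_zero_iff)
    ultimately have "length xs = Suc K" by simp
    then show "bin_cardinalities n m f = xs"
      unfolding bc using A by (intro nth_equalityI) (auto simp del: upt_Suc)
  qed
qed

text \<open>A count in two stages: arrangements of the loads among the bins, then allocations for
  each arrangement. The second number is the same for all arrangements, because the product of the
  factorials of the loads depends on their multiset only.\<close>

lemma card_bin_cardinalities:
  assumes n: "1 \<le> n" and xs: "sum_list xs = n" "(\<Sum>i<length xs. i * xs ! i) = m" "last xs \<noteq> 0"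
  shows "card {f \<in> allocations n m. bin_cardinalities n m f = xs} *
    (\<Prod>i<length xs. fact (xs ! i) * fact i ^ (xs ! i)) = fact n * fact m"
proof -
  let ?P = "permutations_of_multiset (value_mset xs)"
  have ne: "xs \<noteq> []" using xs n by auto
  have "{f \<in> allocations n m. bin_cardinalities n m f = xs} = (\<Union>N\<in>?P. {f \<in> allocations n m. loads n m f = N})"
    using ne xs by (auto simp: bin_cardinalities_eq_iff[OF n] permutations_of_multiset_def)
  then have card: "card {f \<in> allocations n m. bin_cardinalities n m f = xs} =
      (\<Sum>N\<in>?P. card {f \<in> allocations n m. loads n m f = N})"
    by (simp only:) (subst card_UN_disjoint, auto)
  have each: "card {f \<in> allocations n m. loads n m f = N} * (\<Prod>v\<in>#value_mset xs. fact v) = fact m" if "N \<in> ?P" for N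
  proof -
    have N: "mset N = value_mset xs" using that by (simp add: permutations_of_multiset_def)
    have len: "length N = n" using N xs by (metis size_mset size_value_mset)
    have sum: "sum_list N = m" using N xs by (metis sum_mset_sum_list sum_value_mset)
    have "(\<Prod>i<n. fact (N ! i) :: nat) = (\<Prod>v\<in>#mset N. fact v)"
      using len prod.list_conv_set_nth[of "map fact N :: nat list"] prod_mset_prod_list[of "map fact N :: nat list"]
      by (simp add: atLeast0LessThan)
    then show ?thesis using card_allocations_with_loads[OF len sum] N by simp
  qed
  have "card {f \<in> allocations n m. bin_cardinalities n m f = xs} * (\<Prod>v\<in>#value_mset xs. fact v) = card ?P * fact m"
    unfolding card sum_distrib_right using each by simp
  then have "card {f \<in> allocations n m. bin_cardinalities n m f = xs} *
      ((\<Prod>j<length xs. fact (xs ! j)) * (\<Prod>j<length xs. fact j ^ (xs ! j))) =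
      (card ?P * (\<Prod>j<length xs. fact (xs ! j))) * fact m"
    unfolding prod_value_mset by (simp only: mult_ac)
  also have "card ?P * (\<Prod>j<length xs. fact (xs ! j)) = fact n"
    using card_permutations_value_mset[of xs] xs by simp
  finally show ?thesis by (simp only: prod.distrib)
qed

lemma pmf_bin_cardinalities:
  assumes n: "1 \<le> n"
  shows "pmf (bin_cardinalities_pmf n m) xs = outcome_weight 0 n m xs / configurations 0 n m"
proof -
  have ne: "allocations n m \<noteq> {}" using n card_allocations[of n m] by (metis card.empty not_one_le_zero power_eq_0_iff)
  let ?S = "{f \<in> allocations n m. bin_cardinalities n m f = xs}"
  let ?c = "sum_list xs = n \<and> (\<Sum>i<length xs. i * xs ! i) = m \<and> (xs = [] \<or> last xs \<noteq> 0)"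
  have "pmf (bin_cardinalities_pmf n m) xs = card ?S / real n ^ m"
    using ne by (simp add: bin_cardinalities_pmf_def allocation_pmf_eq[OF n] pmf_map measure_pmf_of_set
        card_allocations vimage_def Int_def)
  moreover have "real (card ?S) = fact m * outcome_weight 0 n m xs"
  proof (cases ?c)
    case True
    then have "last xs \<noteq> 0" using n by auto
    then have "real (card ?S) * (\<Prod>i<length xs. fact (xs ! i) * fact i ^ (xs ! i)) = fact n * fact m"
      using arg_cong[OF card_bin_cardinalities[OF n, of xs m], of real] True by simp
    moreover have "(\<Prod>i<length xs. fact (xs ! i) * fact i ^ (xs ! i) :: real) \<noteq> 0" by simp
    ultimately show ?thesis using True by (simp add: outcome_weight_eq field_simps)
  next
    case False
    have "?S = {}"
    proof (rule ccontr)
      assume "?S \<noteq> {}"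
      then obtain f where f: "f \<in> allocations n m" "mset (loads n m f) = value_mset xs" "last xs \<noteq> 0"
        by (auto simp: bin_cardinalities_eq_iff[OF n])
      have "sum_list xs = n" using f(2) size_value_mset[of xs] by (metis diff_zero length_map length_upt loads_def size_mset)
      moreover have "(\<Sum>i<length xs. i * xs ! i) = m"
        using f sum_loads[OF f(1)] by (metis sum_mset_sum_list sum_value_mset)
      ultimately show False using False f(3) by simp
    qed
    then show ?thesis using False by (auto simp: outcome_weight_eq)
  qed
  ultimately show ?thesis by (simp add: configurations_from_0)
qed

section \<open>The law of the output and the running time\<close>

definition sampled_cardinalities :: "nat \<Rightarrow> nat \<Rightarrow> real \<Rightarrow> nat list" where
  "sampled_cardinalities n m r = bins_from 0 n m (frac r)"

abbreviation unit_source :: "real measure" where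
  "unit_source \<equiv> uniform_measure lborel {0<..<1}"

lemma prob_space_unit_source: "prob_space unit_source"
  by (rule prob_space_uniform_measure) auto

lemma measurable_sampled_cardinalities:
  assumes "1 \<le> n"
  shows "sampled_cardinalities n m \<in> borel \<rightarrow>\<^sub>M count_space UNIV"
proof (subst measurable_count_space_eq_countable)
  show "sampled_cardinalities n m \<in> space borel \<rightarrow> UNIV \<and>
    (\<forall>xs\<in>UNIV. sampled_cardinalities n m -` {xs} \<inter> space borel \<in> sets borel)"
  proof (intro conjI ballI)
    fix xs
    have "0 < configurations 0 n m" using assms by (simp add: configurations_from_0)
    from bins_from_interval[OF this, of xs] obtain l where "\<forall>u. 0 \<le> u \<and> u < 1 \<and> bins_from 0 n m u = xs \<longleftrightarrow>
        l \<le> u \<and> u < l + outcome_weight 0 n m xs / configurations 0 n m" by (rule exE)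
    note l = this[rule_format]
    have "bins_from 0 n m (frac r) = xs \<longleftrightarrow>
        l \<le> frac r \<and> frac r < l + outcome_weight 0 n m xs / configurations 0 n m" for r
      using l[of "frac r"] by (simp add: frac_lt_1)
    then have "sampled_cardinalities n m -` {xs} =
        {r. l \<le> frac r \<and> frac r < l + outcome_weight 0 n m xs / configurations 0 n m}"
      by (simp add: sampled_cardinalities_def vimage_def)
    also have "\<dots> \<in> sets borel" unfolding frac_def by measurable
    finally show "sampled_cardinalities n m -` {xs} \<inter> space borel \<in> sets borel" by simp
  qed simp
qed simp

lemma distr_sampled_cardinalities:
  assumes "1 \<le> n"
  shows "distr unit_source (count_space UNIV) (sampled_cardinalities n m) = measure_pmf (bin_cardinalities_pmf n m)"
proof (rule measure_eqI_countable)
  fix xs :: "nat list"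
  let ?q = "outcome_weight 0 n m xs / configurations 0 n m"
  have c: "0 < configurations 0 n m" using assms by (simp add: configurations_from_0)
  have q0: "0 \<le> ?q" using c outcome_weight_nonneg by simp
  from bins_from_interval[OF c, of xs] obtain l where "\<forall>u. 0 \<le> u \<and> u < 1 \<and> bins_from 0 n m u = xs \<longleftrightarrow>
      l \<le> u \<and> u < l + ?q" by (rule exE)
  note l = this[rule_format]
  have "(frac u :: real) = u" if "0 < u" "u < 1" for u using that by (simp add: frac_eq)
  \<comment> \<open>The source lives on the open unit interval, whereas the outcome intervals lie in
    [0, 1); the point 0 is removed here and is a null set.\<close>
  then have "{0<..<1} \<inter> sampled_cardinalities n m -` {xs} = {u. 0 \<le> u \<and> u < 1 \<and> bins_from 0 n m u = xs} - {0}"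
    by (auto simp: sampled_cardinalities_def)
  also have "\<dots> = {l..<l + ?q} - {0}" unfolding l by auto
  finally have eq: "{0<..<1} \<inter> sampled_cardinalities n m -` {xs} = {l..<l + ?q} - {0}" .
  have meas [measurable]: "sampled_cardinalities n m \<in> borel \<rightarrow>\<^sub>M count_space UNIV"
    by (rule measurable_sampled_cardinalities[OF assms])
  have pre: "sampled_cardinalities n m -` {xs} \<in> sets borel"
    using measurable_sets[OF meas, of "{xs}"] by simp
  have "emeasure (distr unit_source (count_space UNIV) (sampled_cardinalities n m)) {xs} =
      emeasure unit_source (sampled_cardinalities n m -` {xs})"
    by (subst emeasure_distr) (auto intro: measurable_sampled_cardinalities[OF assms])
  also have "\<dots> = emeasure lborel ({l..<l + ?q} - {0})"
    using pre by (simp add: emeasure_uniform_measure eq divide_ennreal_def)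
  also have "\<dots> = emeasure lborel {l..<l + ?q}"
    by (rule emeasure_Diff_null_set) (auto intro: finite_imp_null_set_lborel)
  also have "\<dots> = ennreal ?q" using q0 by simp
  also have "\<dots> = emeasure (measure_pmf (bin_cardinalities_pmf n m)) {xs}"
    by (simp add: emeasure_pmf_single pmf_bin_cardinalities[OF assms])
  finally show "emeasure (distr unit_source (count_space UNIV) (sampled_cardinalities n m)) {xs} =
      emeasure (measure_pmf (bin_cardinalities_pmf n m)) {xs}" .
qed auto

lemma distr_shd:
  assumes "prob_space M" shows "distr (stream_space M) M shd = M"
proof (rule measure_eqI)
  interpret prob_space M by fact
  interpret S: prob_space "stream_space M" by (rule prob_space_stream_space)
  fix A assume "A \<in> sets (distr (stream_space M) M shd)"
  then have A [measurable]: "A \<in> sets M" by simp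
  have "emeasure (distr (stream_space M) M shd) A = (\<integral>\<^sup>+x. indicator A (shd x) \<partial>stream_space M)"
    by (simp add: nn_integral_distr flip: nn_integral_indicator)
  also have "\<dots> = (\<integral>\<^sup>+x. (\<integral>\<^sup>+y. indicator A x \<partial>stream_space M) \<partial>M)"
    by (subst nn_integral_stream_space) auto
  also have "\<dots> = emeasure M A"
    by (simp add: S.emeasure_space_1)
  finally show "emeasure (distr (stream_space M) M shd) A = emeasure M A" .
qed simp

lemma measurable_output:
  assumes "1 \<le> n"
  shows "(\<lambda>\<omega>. sampled_cardinalities n m (shd \<omega>)) \<in> random_source \<rightarrow>\<^sub>M count_space UNIV"
  unfolding random_source_def
  by (rule measurable_compose[OF measurable_shd])
    (use measurable_sampled_cardinalities[OF assms] in \<open>simp cong: measurable_cong_sets\<close>)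

lemma distr_output:
  assumes "1 \<le> n"
  shows "distr random_source (count_space UNIV) (\<lambda>\<omega>. sampled_cardinalities n m (shd \<omega>)) =
    measure_pmf (bin_cardinalities_pmf n m)"
proof -
  have "distr random_source (count_space UNIV) (\<lambda>\<omega>. sampled_cardinalities n m (shd \<omega>)) =
      distr (distr random_source unit_source shd) (count_space UNIV) (sampled_cardinalities n m)"
    unfolding random_source_def
    by (subst distr_distr) (use measurable_sampled_cardinalities[OF assms] in \<open>auto simp: o_def cong: measurable_cong_sets\<close>)
  then show ?thesis
    unfolding random_source_def distr_shd[OF prob_space_unit_source] distr_sampled_cardinalities[OF assms] .
qed

lemma outputs_cardinalities_cmd:
  assumes "1 \<le> n" "1 \<le> m"
  shows "outputs cardinalities_cmd n m \<omega> (map real (sampled_cardinalities n m (shd \<omega>)))"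
  using cardinalities_cmd_exec[OF assms, of \<omega>]
  unfolding outputs_def sampled_cardinalities_def by auto

lemma running_time_cardinalities_cmd:
  assumes "1 \<le> n" "1 \<le> m"
  shows "running_time cardinalities_cmd n m \<omega> =
    of_nat (fixed_cost + level_cost * length (sampled_cardinalities n m (shd \<omega>)))"
  using cardinalities_cmd_exec[OF assms, of \<omega>] running_time_eq
  unfolding sampled_cardinalities_def by blast

section \<open>Tail and mean of the maximum occupancy\<close>

lemma occupancy_le: "occupancy m f i \<le> m"
proof -
  have "card {b. b < m \<and> f b = i} \<le> card {..<m}" by (intro card_mono) auto
  then show ?thesis by (simp add: occupancy_def)
qed

lemma max_occupancy_less_iff:
  assumes "1 \<le> n" shows "t < real (max_occupancy n m f) \<longleftrightarrow> (\<exists>i<n. t < real (occupancy m f i))"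
proof -
  have fin: "finite (occupancy m f ` {..<n})" "occupancy m f ` {..<n} \<noteq> {}"
    using assms by (auto simp: lessThan_empty_iff)
  have "max_occupancy n m f \<in> occupancy m f ` {..<n}"
    unfolding max_occupancy_def by (rule Max_in[OF fin])
  moreover have "occupancy m f i \<le> max_occupancy n m f" if "i < n" for i
    unfolding max_occupancy_def using that fin by (intro Max_ge) auto
  ultimately show ?thesis by (auto simp: not_le intro: less_le_trans)
qed

lemma max_occupancy_le: "1 \<le> n \<Longrightarrow> max_occupancy n m f \<le> m"
  unfolding max_occupancy_def
  by (subst Max_le_iff) (auto simp: lessThan_empty_iff occupancy_le)

lemma finite_allocation_pmf: "1 \<le> n \<Longrightarrow> finite (set_pmf (allocation_pmf n m))"
proof -
  assume n: "1 \<le> n"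
  then have "allocations n m \<noteq> {}"
    using card_allocations[of n m] by (metis card.empty not_one_le_zero power_eq_0_iff)
  then show ?thesis by (simp add: allocation_pmf_eq[OF n])
qed

text \<open>The power is a product of independent factors, one per ball, each with mean 1 + (s - 1)
  / n \<le> exp (s / n).\<close>

lemma expectation_power_occupancy:
  fixes s :: real
  assumes n: "1 \<le> n" and i: "i < n" and s: "0 \<le> s"
  shows "measure_pmf.expectation (allocation_pmf n m) (\<lambda>f. s ^ occupancy m f i) \<le> exp (s * m / n)"
proof -
  let ?p = "pmf_of_set {..<n}"
  have ne: "{..<n} \<noteq> {}" using n by (auto simp: lessThan_empty_iff)
  have "s ^ occupancy m f i = (\<Prod>b<m. if f b = i then s else 1)" for f
    by (simp add: occupancy_def prod.If_cases Int_def)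
  then have "measure_pmf.expectation (allocation_pmf n m) (\<lambda>f. s ^ occupancy m f i) =
      (\<Prod>b<m. measure_pmf.expectation ?p (\<lambda>x. if x = i then s else 1))"
    unfolding allocation_pmf_def
    by (simp only:) (rule expectation_prod_Pi_pmf,
      auto simp: s intro!: integrable_measure_pmf_finite simp: ne)
  also have "measure_pmf.expectation ?p (\<lambda>x. if x = i then s else 1) = (s + (real n - 1)) / n"
  proof -
    have "(\<Sum>x<n. if x = i then s else 1) = (\<Sum>x\<in>{..<n} - {i}. 1) + s"
      using i by (subst sum.remove[of _ i]) auto
    then show ?thesis using i ne by (simp add: integral_pmf_of_set)
  qed
  also have "(s + (real n - 1)) / n \<le> exp (s / n)"
  proof -
    have "(s + (real n - 1)) / n \<le> 1 + s / n" using n by (simp add: field_simps)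
    also have "\<dots> \<le> exp (s / n)" by (rule exp_ge_add_one_self)
    finally show ?thesis .
  qed
  then have "(\<Prod>b<m. (s + (real n - 1)) / n) \<le> (\<Prod>b<m. exp (s / n))"
    using n s by (intro prod_mono) auto
  also have "\<dots> = exp (s * m / n)" by (simp flip: exp_of_nat_mult)
  finally show ?thesis .
qed

lemma occupancy_tail:
  assumes n: "1 \<le> n" and i: "i < n" and s: "1 \<le> s"
  shows "measure_pmf.prob (allocation_pmf n m) {f. t < real (occupancy m f i)} \<le> exp (s * m / n - t * ln s)"
proof -
  let ?p = "allocation_pmf n m"
  note fin = integrable_measure_pmf_finite[OF finite_allocation_pmf[OF n]]
  have "measure_pmf.prob ?p {f. t < real (occupancy m f i)} =
      measure_pmf.expectation ?p (indicator {f. t < real (occupancy m f i)})" by simp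
  also have "\<dots> \<le> measure_pmf.expectation ?p (\<lambda>f. exp (- t * ln s) * s ^ occupancy m f i)"
  proof (rule integral_mono)
    fix f
    have pow: "s ^ occupancy m f i = exp (real (occupancy m f i) * ln s)"
      using s by (simp add: exp_of_nat_mult)
    have "t < real (occupancy m f i) \<Longrightarrow> t * ln s \<le> real (occupancy m f i) * ln s"
      using s by (intro mult_right_mono) auto
    then show "indicator {f. t < real (occupancy m f i)} f \<le> exp (- t * ln s) * s ^ occupancy m f i"
      unfolding pow exp_add[symmetric] by (simp add: indicator_def)
  qed (rule fin)+
  also have "\<dots> = exp (- t * ln s) * measure_pmf.expectation ?p (\<lambda>f. s ^ occupancy m f i)" by simp
  also have "\<dots> \<le> exp (- t * ln s) * exp (s * m / n)"
    using s by (intro mult_left_mono expectation_power_occupancy[OF n i]) auto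
  also have "\<dots> = exp (s * m / n - t * ln s)" by (simp flip: exp_add)
  finally show ?thesis .
qed

context
  fixes n m :: nat and D L :: real
  assumes n2: "2 \<le> n" and nm: "n \<le> m" and mn: "real m \<le> real n * ln (real n)"
  defines "D \<equiv> 4 * real n / real m * ln (real n)" and "L \<equiv> ln (real n) / ln D"
begin

lemma D_bounds: "4 \<le> D" "D \<le> 4 * ln (real n)"
proof -
  have m: "0 < m" using n2 nm by simp
  have ln: "0 < ln (real n)" using n2 by simp
  show "4 \<le> D" using mn m by (simp add: D_def field_simps)
  have "real n / real m \<le> 1" using nm m by simp
  then have "real n / real m * ln (real n) \<le> 1 * ln (real n)" using ln by (intro mult_right_mono) auto
  then show "D \<le> 4 * ln (real n)" by (simp add: D_def)
qed

text \<open>Lets costs that do not depend on n and m be absorbed into a multiple of L.\<close>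

lemma L_ge: "1 / 4 \<le> L"
proof -
  have "ln D \<le> D" using ln_bound[of D] D_bounds by simp
  then have "ln D \<le> 4 * ln (real n)" using D_bounds by simp
  moreover have "0 < ln D" using D_bounds by simp
  ultimately show ?thesis by (simp add: L_def field_simps)
qed

lemma max_occupancy_tail:
  "measure_pmf.prob (allocation_pmf n m) {f. 12 * L < real (max_occupancy n m f)} \<le> 1 / real n ^ 3"
proof -
  have n1: "1 \<le> n" and n0: "0 < real n" and m0: "0 < real m" using n2 nm by simp_all
  \<comment> \<open>With s = sqrt D one has s * (s * m / n) = 4 ln n and s \<ge> 2, so s * m / n
    \<le> 2 ln n, while ln s = ln D / 2 turns 12 * L * ln s into 6 ln n. The exponent is thus at
    most -4 ln n, and the union over n bins loses one power of n.\<close>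
  let ?s = "sqrt D"
  have "sqrt 4 \<le> ?s" using D_bounds by (intro real_sqrt_le_mono) simp
  then have s: "2 \<le> ?s" by simp
  have "?s * ?s = D" using D_bounds by simp
  then have "?s * (?s * m / n) = 4 * ln (real n)" using n0 m0 by (simp add: D_def flip: mult.assoc)
  moreover have "2 * (?s * m / n) \<le> ?s * (?s * m / n)"
    using s D_bounds by (intro mult_right_mono divide_nonneg_nonneg mult_nonneg_nonneg) auto
  ultimately have a: "?s * m / n \<le> 2 * ln (real n)" by simp
  have "ln ?s = ln D / 2" using D_bounds by (simp add: ln_sqrt)
  moreover have "0 < ln D" using D_bounds by simp
  ultimately have b: "12 * L * ln ?s = 6 * ln (real n)" by (simp only:) (simp add: L_def)
  have "measure_pmf.prob (allocation_pmf n m) {f. 12 * L < real (occupancy m f i)} \<le> 1 / real n ^ 4"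
    if "i < n" for i
  proof -
    have "measure_pmf.prob (allocation_pmf n m) {f. 12 * L < real (occupancy m f i)} \<le> exp (?s * m / n - 12 * L * ln ?s)"
      using D_bounds by (intro occupancy_tail[OF n1 that]) simp
    also have "\<dots> \<le> exp (- (real 4 * ln (real n)))" using a b by simp
    also have "\<dots> = 1 / real n ^ 4" using n0 by (simp only: exp_minus exp_of_nat_mult exp_ln inverse_eq_divide)
    finally show ?thesis .
  qed
  then have each: "(\<Sum>i<n. measure_pmf.prob (allocation_pmf n m) {f. 12 * L < real (occupancy m f i)}) \<le> (\<Sum>i<n. 1 / real n ^ 4)"
    by (intro sum_mono) simp
  have "{f. 12 * L < real (max_occupancy n m f)} = (\<Union>i<n. {f. 12 * L < real (occupancy m f i)})"
    by (auto simp: max_occupancy_less_iff[OF n1])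
  then have "measure_pmf.prob (allocation_pmf n m) {f. 12 * L < real (max_occupancy n m f)} \<le>
      (\<Sum>i<n. measure_pmf.prob (allocation_pmf n m) {f. 12 * L < real (occupancy m f i)})"
    by (simp only:) (rule measure_pmf.finite_measure_subadditive_finite, auto)
  also note each
  also have "(\<Sum>i<n. 1 / real n ^ 4) = 1 / real n ^ 3" using n0 by (simp add: field_simps power_numeral_reduce)
  finally show ?thesis .
qed

text \<open>Off the exceptional event the maximum is at most 12 * L; on it the trivial bound m
  applies, and m \<le> n ln n \<le> n^3 makes its contribution at most 1.\<close>

lemma expectation_max_occupancy:
  "measure_pmf.expectation (allocation_pmf n m) (\<lambda>f. real (max_occupancy n m f)) \<le> 12 * L + 1"
proof -
  have n1: "1 \<le> n" and n0: "0 < real n" using n2 by simp_all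
  let ?p = "allocation_pmf n m"
  let ?A = "{f. 12 * L < real (max_occupancy n m f)}"
  note fin = integrable_measure_pmf_finite[OF finite_allocation_pmf[OF n1]]
  have "measure_pmf.expectation ?p (\<lambda>f. real (max_occupancy n m f)) \<le>
      measure_pmf.expectation ?p (\<lambda>f. 12 * L + real m * indicator ?A f)"
    using L_ge max_occupancy_le[OF n1, of m] by (intro integral_mono fin) (auto simp: indicator_def intro: add_increasing)
  also have "\<dots> = 12 * L + real m * measure_pmf.prob ?p ?A"
    by (subst Bochner_Integration.integral_add) (auto intro: fin)
  also have "\<dots> \<le> 12 * L + real m * (1 / real n ^ 3)"
    by (intro add_left_mono mult_left_mono max_occupancy_tail) simp
  also have "real m * (1 / real n ^ 3) \<le> 1"
  proof -
    have "ln (real n) \<le> real n" using ln_bound[of "real n"] n0 by simp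
    then have "real n * ln (real n) \<le> real n * real n" using n0 by (intro mult_left_mono) auto
    also have "\<dots> \<le> real n ^ 3" using n2 by (simp add: power3_eq_cube)
    finally have "real m \<le> real n ^ 3" using mn by linarith
    then show ?thesis
      using n0 by (simp only: mult_1_right times_divide_eq_right divide_le_eq_1_pos zero_less_power)
  qed
  finally show ?thesis by simp
qed

text \<open>The vector has k + 1 entries, hence d * (12 * L + 2). By L \<ge> 1/4 the constants cost
  c \<le> 4 * c * L and 2 * d \<le> 8 * d * L, which gives 4 * c + 20 * d; the summand 1 makes the
  factor positive.\<close>

lemma cost_bound:
  fixes c d k :: real
  assumes "0 \<le> c" "0 \<le> d" "k \<le> 12 * L + 1"
  shows "c + d * (k + 1) \<le> (4 * c + 20 * d + 1) * L"
proof -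
  have "d * (k + 1) \<le> d * (12 * L + 2)" using assms by (intro mult_left_mono) auto
  moreover have "(4 * c + 8 * d) * (1 / 4) \<le> (4 * c + 8 * d) * L"
    using L_ge assms by (intro mult_left_mono) auto
  ultimately show ?thesis using L_ge by (simp add: algebra_simps)
qed

end

theorem theorem1:
  shows "\<exists>(C::real) (p::cmd) (\<epsilon>::nat \<Rightarrow> real). C > 0 \<and> \<epsilon> \<longlonglongrightarrow> 0 \<and>
    (\<forall>n m::nat. 2 \<le> n \<and> n \<le> m \<and> real m \<le> real n * ln (real n) \<longrightarrow>
      (\<exists>X \<in> random_source \<rightarrow>\<^sub>M count_space (UNIV :: nat list set).
         (AE \<omega> in random_source. outputs p n m \<omega> (map real (X \<omega>))) \<and>
         distr random_source (count_space UNIV) X = measure_pmf (bin_cardinalities_pmf n m)) \<and>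
      running_time p n m \<in> borel_measurable random_source \<and>
      (\<integral>\<^sup>+ \<omega>. running_time p n m \<omega> \<partial>random_source)
        \<le> ennreal (C * (ln (real n) / ln (4 * real n / real m * ln (real n)))) \<and>
      measure random_source {\<omega> \<in> space random_source. running_time p n m \<omega>
          \<le> ennreal (C * (ln (real n) / ln (4 * real n / real m * ln (real n))))} \<ge> 1 - \<epsilon> n)"
proof -
  define C where "C = 4 * real fixed_cost + 20 * real level_cost + 1"
  have "C > 0" by (simp add: C_def add_nonneg_pos)
  moreover have "(\<lambda>n. 1 / real n) \<longlonglongrightarrow> 0" by (rule lim_1_over_n)
  moreover have "(\<exists>X \<in> random_source \<rightarrow>\<^sub>M count_space (UNIV :: nat list set).
         (AE \<omega> in random_source. outputs cardinalities_cmd n m \<omega> (map real (X \<omega>))) \<and>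
         distr random_source (count_space UNIV) X = measure_pmf (bin_cardinalities_pmf n m)) \<and>
      running_time cardinalities_cmd n m \<in> borel_measurable random_source \<and>
      (\<integral>\<^sup>+ \<omega>. running_time cardinalities_cmd n m \<omega> \<partial>random_source)
        \<le> ennreal (C * (ln (real n) / ln (4 * real n / real m * ln (real n)))) \<and>
      measure random_source {\<omega> \<in> space random_source. running_time cardinalities_cmd n m \<omega>
          \<le> ennreal (C * (ln (real n) / ln (4 * real n / real m * ln (real n))))} \<ge> 1 - 1 / real n"
    if H: "2 \<le> n \<and> n \<le> m \<and> real m \<le> real n * ln (real n)" for n m :: nat
  proof -
    have n1: "1 \<le> n" and m1: "1 \<le> m" using H by auto
    note H' = conjunct1[OF H] conjunct1[OF conjunct2[OF H]] conjunct2[OF conjunct2[OF H]]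
    define L where "L = ln (real n) / ln (4 * real n / real m * ln (real n))"
    define X where "X = (\<lambda>\<omega>. sampled_cardinalities n m (shd \<omega>))"
    define T where "T = (\<lambda>xs :: nat list. of_nat (fixed_cost + level_cost * length xs) :: ennreal)"
    note cost = cost_bound[OF H', of fixed_cost level_cost, folded L_def C_def, simplified]
    have X: "X \<in> random_source \<rightarrow>\<^sub>M count_space UNIV"
      unfolding X_def by (rule measurable_output[OF n1])
    have dX: "distr random_source (count_space UNIV) X = measure_pmf (bin_cardinalities_pmf n m)"
      unfolding X_def by (rule distr_output[OF n1])
    have rt: "running_time cardinalities_cmd n m = (\<lambda>\<omega>. T (X \<omega>))"
      by (simp add: fun_eq_iff running_time_cardinalities_cmd[OF n1 m1] T_def X_def)
    have Tr: "T (bin_cardinalities n m f) = ennreal (fixed_cost + level_cost * (real (max_occupancy n m f) + 1))" for f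
      by (simp add: T_def bin_cardinalities_def ennreal_of_nat_eq_real_of_nat add.commute del: upt_Suc)
    note fin = integrable_measure_pmf_finite[OF finite_allocation_pmf[OF n1]]
    \<comment> \<open>The running time is a function of the output alone, so its law can be computed
      from random allocations instead of from the program.\<close>
    have "(\<integral>\<^sup>+ \<omega>. T (X \<omega>) \<partial>random_source) = (\<integral>\<^sup>+ xs. T xs \<partial>distr random_source (count_space UNIV) X)"
      using X by (subst nn_integral_distr) auto
    also have "\<dots> = (\<integral>\<^sup>+ f. T (bin_cardinalities n m f) \<partial>allocation_pmf n m)"
      unfolding dX bin_cardinalities_pmf_def by simp
    also have "\<dots> = ennreal (measure_pmf.expectation (allocation_pmf n m)
        (\<lambda>f. fixed_cost + level_cost * (real (max_occupancy n m f) + 1)))"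
      unfolding Tr by (rule nn_integral_eq_integral) (auto intro: fin)
    also have "measure_pmf.expectation (allocation_pmf n m)
        (\<lambda>f. fixed_cost + level_cost * (real (max_occupancy n m f) + 1)) =
        fixed_cost + level_cost * (measure_pmf.expectation (allocation_pmf n m) (\<lambda>f. real (max_occupancy n m f)) + 1)"
    proof -
      have "integrable (allocation_pmf n m) (\<lambda>f. real (max_occupancy n m f))" by (rule fin)
      then show ?thesis by simp
    qed
    also have "ennreal \<dots> \<le> ennreal (C * L)"
      using expectation_max_occupancy[OF H', folded L_def] by (intro ennreal_leI cost)
    finally have E: "(\<integral>\<^sup>+ \<omega>. T (X \<omega>) \<partial>random_source) \<le> ennreal (C * L)" .
    have "real n ^ 1 \<le> real n ^ 3" using n1 by (intro power_increasing) auto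
    then have "1 - 1 / real n \<le> 1 - 1 / real n ^ 3" using n1 by (simp add: frac_le)
    also have "\<dots> \<le> 1 - measure_pmf.prob (allocation_pmf n m) {f. 12 * L < real (max_occupancy n m f)}"
      using max_occupancy_tail[OF H', folded L_def] by simp
    also have "\<dots> = measure_pmf.prob (allocation_pmf n m) (- {f. 12 * L < real (max_occupancy n m f)})"
      by (subst measure_pmf.prob_compl[symmetric]) (auto simp: Compl_eq_Diff_UNIV)
    also have "\<dots> \<le> measure_pmf.prob (allocation_pmf n m) {f. T (bin_cardinalities n m f) \<le> ennreal (C * L)}"
    proof (rule measure_pmf.finite_measure_mono)
      show "- {f. 12 * L < real (max_occupancy n m f)} \<subseteq> {f. T (bin_cardinalities n m f) \<le> ennreal (C * L)}"
      proof
        fix f assume "f \<in> - {f. 12 * L < real (max_occupancy n m f)}"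
        then have "real (max_occupancy n m f) \<le> 12 * L + 1" by simp
        then show "f \<in> {f. T (bin_cardinalities n m f) \<le> ennreal (C * L)}"
          unfolding Tr mem_Collect_eq by (intro ennreal_leI cost)
      qed
    qed simp
    also have "\<dots> = measure (distr random_source (count_space UNIV) X) {xs. T xs \<le> ennreal (C * L)}"
      unfolding dX bin_cardinalities_pmf_def by (simp add: vimage_def)
    also have "\<dots> = measure random_source {\<omega> \<in> space random_source. T (X \<omega>) \<le> ennreal (C * L)}"
      using X by (subst measure_distr) (auto simp: vimage_def Int_def conj_commute)
    finally have P: "1 - 1 / real n \<le> measure random_source {\<omega> \<in> space random_source. T (X \<omega>) \<le> ennreal (C * L)}" .
    have "(\<lambda>\<omega>. T (X \<omega>)) \<in> borel_measurable random_source"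
      by (rule measurable_compose[OF X]) simp
    moreover have "AE \<omega> in random_source. outputs cardinalities_cmd n m \<omega> (map real (X \<omega>))"
      unfolding X_def using outputs_cardinalities_cmd[OF n1 m1] by (intro AE_I2)
    ultimately show ?thesis
      using X dX E P unfolding rt L_def[symmetric] by blast
  qed
  ultimately show ?thesis by blast
qed

end
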